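(* Let $n\in\mathbb{N}$ and consider $(2\times n)$-games, i.e. two-player games in which player 1 has $d_1=2$ strategies and player 2 has $d_2=n$ strategies. Let $A(Y)$ be the associated matrix and $\partial_a\mathcal{R}$ the algebraic boundary of the oriented matroid stratification, as defined in the context. Then the irreducible components of $\partial_a\mathcal{R}$ are given by (i) the coordinate hyperplanes, and (ii) hypersurfaces defined by quadratic binomials that are given by certain $(2\times2)$-minors and $(4\times4)$-minors of the matrix $A(Y)$.
   Context: For a positive integer $m$ write $[m]=\{1,\dots,m\}$. For $(2\times n)$-games put $D=2n$, $N=2+n(n-1)$ and $M=n+2\binom n2=n+n(n-1)$. The $M$ variables (coordinates of $\mathbb{R}^M$) are - $Y^{(1)}_k(1,2)$ for $k\in[n]$ (standing for the payoff differences $X^{(1)}_{1k}-X^{(1)}_{2k}$ of player 1), and - $Y^{(2)}_j(k,l)$ for $j\in\{1,2\}$ and $1\le k<l\le n$ (standing for the payoff differences $X^{(2)}_{jk}-X^{(2)}_{jl}$ of player 2). For $k>l$ set $Y^{(2)}_j(k,l)=-Y^{(2)}_j(l,k)$. The stratification below is a stratification of all of $\mathbb{R}^M$; no linear relations among the $M$ variables are imposed. Index the coordinates of $\mathbb{R}^D$ by pairs $(j,k)$ with $j\in[2]$, $k\in[n]$, with standard basis vectors $e_{jk}$. The matrix $A(Y)=\begin{pmatrix}U(Y)\\ \mathrm{Id}_D\end{pmatrix}$ is the $((D+N)\times D)$-matrix in which $U(Y)$ has the $N$ rows $$\sum_{k=1}^n Y^{(1)}_k(1,2)\,e_{1k},\qquad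 -\sum_{k=1}^nY^{(1)}_k(1,2)\,e_{2k},\qquad Y^{(2)}_1(k,l)\,e_{1k}+Y^{(2)}_2(k,l)\,e_{2k}\quad(k,l\in[n],\ k\neq l).$$ For $H\subseteq[D+N]$ with $|H|=D$, let $A_H(Y)$ be the square submatrix of $A(Y)$ with rows indexed by $H$; $\det A_H(Y)$ is a polynomial in the variables $Y$. The oriented matroid stratification $\mathcal{R}$ of $\mathbb{R}^M$ is the collection of all regions in which the maximal minors $\det A_H(Y)$ satisfy a certain fixed sign pattern. The algebraic boundary of a semialgebraic set is the Zariski closure of its Euclidean boundary. The algebraic boundary $\partial_a\mathcal{R}$ of the oriented matroid stratification is the union of the algebraic boundaries of the Euclidean closures of all maximal open regions of the stratification, given as the union of hypersurfaces $$\partial_a\mathcal{R}=\bigcup_{H}\{Y\in\mathbb{R}^M\mid\det A_H(Y)=0\},$$ where $H$ ranges over the subsets of $[D+N]$ with $|H|=D$ such that $A_H(Y)$ contains at least one variable. *)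

theory Defs
  imports
    "HOL-Library.Poly_Mapping"
    "HOL-Analysis.Function_Topology"
    "Jordan_Normal_Form.Determinant"
    "Jordan_Normal_Form.DL_Submatrix"
begin

text \<open>
  \<open>Y1 k\<close> stands for $Y^{(1)}_k(1,2)$ and \<open>Y2 j k l\<close> for $Y^{(2)}_j(k,l)$.
  Strategies are numbered from 1; only the indices in \<open>vars n\<close> are variables.
\<close>

datatype pvar = Y1 nat | Y2 nat nat nat

definition vars :: "nat \<Rightarrow> pvar set" where
  "vars n = {Y1 k | k. k \<in> {1..n}} \<union>
            {Y2 j k l | j k l. j \<in> {1, 2} \<and> 1 \<le> k \<and> k < l \<and> l \<le> n}"

text \<open>
  $\mathbb{R}^M$ is the product of copies of the real line indexed by \<open>vars n\<close>, so its points
  are functions that take the value \<open>undefined\<close> outside \<open>vars n\<close>.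
\<close>

definition RM :: "nat \<Rightarrow> (pvar \<Rightarrow> real) topology" where
  "RM n = product_topology (\<lambda>_. euclideanreal) (vars n)"

definition diff2 :: "(pvar \<Rightarrow> real) \<Rightarrow> nat \<Rightarrow> nat \<Rightarrow> nat \<Rightarrow> real" where
  "diff2 Y j k l = (if k < l then Y (Y2 j k l) else - Y (Y2 j l k))"


subsection \<open>The matrix \<open>A(Y)\<close>\<close>

text \<open>
  The columns are ordered $(1,1),\dots,(1,n),(2,1),\dots,(2,n)$. Rows and columns of
  matrices are counted from 0.
\<close>

definition basis_vec :: "nat \<Rightarrow> nat \<Rightarrow> nat \<Rightarrow> real vec" where
  "basis_vec n j k = unit_vec (2 * n) ((j - 1) * n + (k - 1))"

definition row_player1 :: "nat \<Rightarrow> (pvar \<Rightarrow> real) \<Rightarrow> nat \<Rightarrow> real vec" where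
  "row_player1 n Y j = vec (2 * n) (\<lambda>c. \<Sum>k = 1..n. Y (Y1 k) * basis_vec n j k $ c)"

definition row_player2 :: "nat \<Rightarrow> (pvar \<Rightarrow> real) \<Rightarrow> nat \<Rightarrow> nat \<Rightarrow> real vec" where
  "row_player2 n Y k l =
     diff2 Y 1 k l \<cdot>\<^sub>v basis_vec n 1 k + diff2 Y 2 k l \<cdot>\<^sub>v basis_vec n 2 k"

definition U_mat :: "nat \<Rightarrow> (pvar \<Rightarrow> real) \<Rightarrow> real mat" where
  "U_mat n Y = mat_of_rows (2 * n)
     ([row_player1 n Y 1, - row_player1 n Y 2] @
      [row_player2 n Y k l. k \<leftarrow> [1..<n + 1], l \<leftarrow> [1..<n + 1], k \<noteq> l])"

definition A_mat :: "nat \<Rightarrow> (pvar \<Rightarrow> real) \<Rightarrow> real mat" where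
  "A_mat n Y = U_mat n Y @\<^sub>r 1\<^sub>m (2 * n)"

definition num_rows :: "nat \<Rightarrow> nat" where
  "num_rows n = 2 * n + (2 + n * (n - 1))"

definition minor :: "nat \<Rightarrow> (pvar \<Rightarrow> real) \<Rightarrow> nat set \<Rightarrow> nat set \<Rightarrow> real" where
  "minor n Y I J = det (submatrix (A_mat n Y) I J)"

definition max_row_sets :: "nat \<Rightarrow> nat set set" where
  "max_row_sets n = {H. H \<subseteq> {..<num_rows n} \<and> card H = 2 * n}"

definition max_minor :: "nat \<Rightarrow> (pvar \<Rightarrow> real) \<Rightarrow> nat set \<Rightarrow> real" where
  "max_minor n Y H = minor n Y H {..<2 * n}"


subsection \<open>The oriented matroid stratification\<close>

definition regions :: "nat \<Rightarrow> (pvar \<Rightarrow> real) set set" where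
  "regions n =
     {R. R \<noteq> {} \<and>
         (\<exists>\<sigma>. R = {Y \<in> topspace (RM n). \<forall>H \<in> max_row_sets n. sgn (max_minor n Y H) = \<sigma> H})}"

definition maximal_open_regions :: "nat \<Rightarrow> (pvar \<Rightarrow> real) set set" where
  "maximal_open_regions n =
     {R \<in> regions n. openin (RM n) R \<and>
        (\<forall>R' \<in> regions n. openin (RM n) R' \<and> R \<subseteq> R' \<longrightarrow> R' = R)}"


subsection \<open>Polynomials and the Zariski topology on \<open>\<real>\<^sup>M\<close>\<close>

text \<open>
  A monomial is its exponent function of type \<open>pvar \<Rightarrow>\<^sub>0 nat\<close>, and a polynomial is the
  finitely supported function from monomials to coefficients.
\<close>

type_synonym poly_Y = "(pvar \<Rightarrow>\<^sub>0 nat) \<Rightarrow>\<^sub>0 real"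

definition polys :: "nat \<Rightarrow> poly_Y set" where
  "polys n = {p. \<forall>m \<in> Poly_Mapping.keys p. Poly_Mapping.keys m \<subseteq> vars n}"

definition eval_monom :: "(pvar \<Rightarrow>\<^sub>0 nat) \<Rightarrow> (pvar \<Rightarrow> real) \<Rightarrow> real" where
  "eval_monom m Y = (\<Prod>v \<in> Poly_Mapping.keys m. Y v ^ Poly_Mapping.lookup m v)"

definition eval_poly :: "poly_Y \<Rightarrow> (pvar \<Rightarrow> real) \<Rightarrow> real" where
  "eval_poly p Y = (\<Sum>m \<in> Poly_Mapping.keys p. Poly_Mapping.lookup p m * eval_monom m Y)"

definition zero_set :: "nat \<Rightarrow> poly_Y set \<Rightarrow> (pvar \<Rightarrow> real) set" where
  "zero_set n P = {Y \<in> topspace (RM n). \<forall>p \<in> P. eval_poly p Y = 0}"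

definition algebraic_set :: "nat \<Rightarrow> (pvar \<Rightarrow> real) set \<Rightarrow> bool" where
  "algebraic_set n V \<longleftrightarrow> (\<exists>P \<subseteq> polys n. V = zero_set n P)"

definition zariski_closure :: "nat \<Rightarrow> (pvar \<Rightarrow> real) set \<Rightarrow> (pvar \<Rightarrow> real) set" where
  "zariski_closure n S = \<Inter> {V. algebraic_set n V \<and> S \<subseteq> V}"

definition irreducible_set :: "nat \<Rightarrow> (pvar \<Rightarrow> real) set \<Rightarrow> bool" where
  "irreducible_set n V \<longleftrightarrow> algebraic_set n V \<and> V \<noteq> {} \<and>
     (\<forall>V1 V2. algebraic_set n V1 \<and> algebraic_set n V2 \<and> V = V1 \<union> V2 \<longrightarrow> V = V1 \<or> V = V2)"

definition irreducible_components :: "nat \<Rightarrow> (pvar \<Rightarrow> real) set \<Rightarrow> (pvar \<Rightarrow> real) set set" where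
  "irreducible_components n V =
     {C. irreducible_set n C \<and> C \<subseteq> V \<and>
         (\<forall>C'. irreducible_set n C' \<and> C \<subseteq> C' \<and> C' \<subseteq> V \<longrightarrow> C' = C)}"


subsection \<open>The algebraic boundary\<close>

definition algebraic_boundary :: "nat \<Rightarrow> (pvar \<Rightarrow> real) set \<Rightarrow> (pvar \<Rightarrow> real) set" where
  "algebraic_boundary n S = zariski_closure n (RM n frontier_of S)"

definition stratification_boundary :: "nat \<Rightarrow> (pvar \<Rightarrow> real) set" where
  "stratification_boundary n =
     (\<Union>R \<in> maximal_open_regions n. algebraic_boundary n (Abstract_Topology.closure_of (RM n) R))"


subsection \<open>Coordinate hyperplanes and quadratic binomials\<close>

definition coordinate_hyperplane :: "nat \<Rightarrow> pvar \<Rightarrow> (pvar \<Rightarrow> real) set" where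
  "coordinate_hyperplane n v = {Y \<in> topspace (RM n). Y v = 0}"

definition monom_degree :: "(pvar \<Rightarrow>\<^sub>0 nat) \<Rightarrow> nat" where
  "monom_degree m = (\<Sum>v \<in> Poly_Mapping.keys m. Poly_Mapping.lookup m v)"

definition quadratic_binomial :: "poly_Y \<Rightarrow> bool" where
  "quadratic_binomial p \<longleftrightarrow> card (Poly_Mapping.keys p) = 2 \<and> Max (monom_degree ` Poly_Mapping.keys p) = 2"

text \<open>
  \<open>p\<close> is what remains of some \<open>r \<times> r\<close> minor of \<open>A(Y)\<close> after splitting off a monomial factor
  with coefficient 1. For \<open>r = 2\<close> and quadratic \<open>p\<close> this monomial is 1, since the minor has degree
  at most 2. For \<open>r = 4\<close> it cannot be dropped: such minors have the form
  $Y^{(1)}_k(1,2)\,Y^{(1)}_m(1,2)\,\bigl(Y^{(2)}_1(k,l)Y^{(2)}_2(m,l') - Y^{(2)}_2(k,l)Y^{(2)}_1(m,l')\bigr)$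
  up to sign.
\<close>

definition given_by_minor :: "nat \<Rightarrow> nat \<Rightarrow> poly_Y \<Rightarrow> bool" where
  "given_by_minor n r p \<longleftrightarrow>
     (\<exists>I J m. I \<subseteq> {..<num_rows n} \<and> J \<subseteq> {..<2 * n} \<and> card I = r \<and> card J = r \<and>
        Poly_Mapping.keys m \<subseteq> vars n \<and>
        (\<forall>Y \<in> topspace (RM n). minor n Y I J = eval_monom m Y * eval_poly p Y))"

end

theory Submission
  imports Defs "HOL-Computational_Algebra.Polynomial"
begin

text \<open>
  Call the coordinate hyperplanes and the quadrics \<open>Y\<^sub>1(P) Y\<^sub>2(Q) = Y\<^sub>2(P) Y\<^sub>1(Q)\<close>, for two different pairs
  \<open>P\<close> and \<open>Q\<close> of strategies of player 2, the walls. Here \<open>Y\<^sub>j(P)\<close> stands for the payoff difference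
  \<open>Y2 j k l\<close> with \<open>P = (k, l)\<close>. The theorem says that the walls are the irreducible components of
  the boundary, and that the quadrics come from minors of \<open>A(Y)\<close>.

  The walls are irreducible since any two points of a wall are joined by a polynomial curve inside it
  (\<open>irreducible_set_if_polynomial_curve_connected\<close>); for a quadric this uses the parametrization of singular
  \<open>2 \<times> 2\<close> matrices by a column and a row. No wall contains another, so the walls are the components of
  their union, and it remains to identify this union with the boundary (\<open>stratification_boundary_eq\<close>).

  The boundary lies in the walls because no sign can change off them. A maximal minor vanishes iff the chosen rows
  have a nonzero kernel vector. Apart from the two rows of player 1, each row is a linear condition on just two
  entries of such a vector, that is, a line in a plane, and off the walls two of these lines coincide only
  if they do so identically. Hence kernel vectors can be carried over from one point off the walls
  to any other point (\<open>kernel_vector_transfer\<close>): a minor that vanishes somewhere off the walls is zero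
  everywhere. Consequently regions through points off the walls are open, and no such point is a frontier point.

  Conversely, each wall comes with a maximal minor that is affine in one variable and whose zero set, away from the
  other walls, is that wall (\<open>hyperplane_minor\<close> and \<open>quadric_minor\<close>). So that minor changes sign across the
  wall, and the points on no other wall are frontier points of a region (\<open>wall_point_in_frontier\<close>).
  By irreducibility the Zariski closures of the frontiers contain the whole wall.

  The \<open>4 \<times> 4\<close> minor that yields a quadric consists of the two rows of player 1 and of one row of
  player 2 for each of the pairs \<open>P\<close> and \<open>Q\<close>, taken at different strategies.
\<close>

section \<open>Polynomials and algebraic sets\<close>

lemma topspace_RM: "topspace (RM n) = extensional (vars n)"
  by (simp add: RM_def PiE_UNIV_domain PiE_def)

lemma eval_monom_superset:
  assumes "finite S" "Poly_Mapping.keys m \<subseteq> S"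
  shows "eval_monom m Y = (\<Prod>v\<in>S. Y v ^ Poly_Mapping.lookup m v)"
  unfolding eval_monom_def
  by (rule prod.mono_neutral_left) (use assms in \<open>auto simp: not_in_keys_iff_lookup_eq_zero\<close>)

lemma eval_poly_superset:
  assumes "finite S" "Poly_Mapping.keys p \<subseteq> S"
  shows "eval_poly p Y = (\<Sum>m\<in>S. Poly_Mapping.lookup p m * eval_monom m Y)"
  unfolding eval_poly_def
  by (rule sum.mono_neutral_left) (use assms in \<open>auto simp: not_in_keys_iff_lookup_eq_zero\<close>)

lemma eval_monom_zero [simp]: "eval_monom 0 Y = 1"
  by (simp add: eval_monom_def)

lemma eval_monom_add: "eval_monom (m + m') Y = eval_monom m Y * eval_monom m' Y"
proof -
  let ?S = "Poly_Mapping.keys m \<union> Poly_Mapping.keys m'"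
  have "Poly_Mapping.keys (m + m') \<subseteq> ?S"
    by (rule keys_add)
  then show ?thesis
    by (simp add: eval_monom_superset[of ?S] lookup_add power_add prod.distrib)
qed

lemma eval_monom_single [simp]: "eval_monom (Poly_Mapping.single v 1) Y = Y v"
  by (simp add: eval_monom_def)

lemma eval_poly_zero [simp]: "eval_poly 0 Y = 0"
  by (simp add: eval_poly_def)

lemma eval_poly_add: "eval_poly (p + q) Y = eval_poly p Y + eval_poly q Y"
proof -
  let ?S = "Poly_Mapping.keys p \<union> Poly_Mapping.keys q"
  have "Poly_Mapping.keys (p + q) \<subseteq> ?S"
    by (rule keys_add)
  then show ?thesis
    by (simp add: eval_poly_superset[of ?S] lookup_add distrib_right sum.distrib)
qed

lemma eval_poly_single [simp]: "eval_poly (Poly_Mapping.single m c) Y = c * eval_monom m Y"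
  by (simp add: eval_poly_def)

lemma poly_induct [case_names zero add]:
  fixes p :: poly_Y
  assumes "P 0" and "\<And>p m c. P p \<Longrightarrow> P (p + Poly_Mapping.single m c)"
  shows "P p"
proof (induction p rule: Poly_Mapping.update_induct)
  case const
  then show ?case by (rule assms(1))
next
  case (update f a b)
  have "Poly_Mapping.update a b f = f + Poly_Mapping.single a b"
    using update(1) by (intro poly_mapping_eqI)
      (auto simp: lookup_update lookup_add lookup_single when_def not_in_keys_iff_lookup_eq_zero)
  then show ?case
    using assms(2) update by simp
qed

text \<open>
  Multiplicativity is what makes a union of two algebraic sets algebraic: it is cut out by the
  products of their equations.
\<close>

lemma eval_poly_mult: "eval_poly (p * q) Y = eval_poly p Y * eval_poly q Y"
proof (induction p rule: poly_induct)
  case zero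
  then show ?case by simp
next
  case (add p m c)
  have "eval_poly (Poly_Mapping.single m c * q) Y = c * eval_monom m Y * eval_poly q Y"
  proof (induction q rule: poly_induct)
    case zero
    then show ?case by simp
  next
    case (add q m' c')
    then show ?case
      by (simp add: distrib_left eval_poly_add mult_single eval_monom_add)
  qed
  then show ?case
    by (simp add: add distrib_right eval_poly_add)
qed

lemma polys_mult: "p \<in> polys n \<Longrightarrow> q \<in> polys n \<Longrightarrow> p * q \<in> polys n"
proof -
  assume p: "p \<in> polys n" and q: "q \<in> polys n"
  show ?thesis unfolding polys_def mem_Collect_eq
  proof
    fix m assume "m \<in> Poly_Mapping.keys (p * q)"
    then obtain a b where "m = a + b" "a \<in> Poly_Mapping.keys p" "b \<in> Poly_Mapping.keys q"
      using keys_mult[of p q] by blast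
    then show "Poly_Mapping.keys m \<subseteq> vars n"
      using p q Poly_Mapping.keys_add[of a b] unfolding polys_def by blast
  qed
qed

lemma algebraic_set_zero_set: "P \<subseteq> polys n \<Longrightarrow> algebraic_set n (zero_set n P)"
  by (auto simp: algebraic_set_def)

lemma algebraic_set_empty: "algebraic_set n {}"
proof -
  have "(1 :: poly_Y) \<in> polys n" "zero_set n {1} = {}"
    by (simp_all add: polys_def zero_set_def eval_poly_def lookup_one)
  then show ?thesis
    using algebraic_set_zero_set[of "{1}" n] by simp
qed

lemma algebraic_set_Int:
  assumes "algebraic_set n V" "algebraic_set n W"
  shows "algebraic_set n (V \<inter> W)"
proof -
  obtain P Q where PQ: "P \<subseteq> polys n" "V = zero_set n P" "Q \<subseteq> polys n" "W = zero_set n Q"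
    using assms by (auto simp: algebraic_set_def)
  moreover have "V \<inter> W = zero_set n (P \<union> Q)"
    by (auto simp: PQ zero_set_def)
  ultimately show ?thesis
    using algebraic_set_zero_set[of "P \<union> Q" n] by simp
qed

lemma algebraic_set_Un:
  assumes "algebraic_set n V" "algebraic_set n W"
  shows "algebraic_set n (V \<union> W)"
proof -
  obtain P Q where PQ: "P \<subseteq> polys n" "V = zero_set n P" "Q \<subseteq> polys n" "W = zero_set n Q"
    using assms by (auto simp: algebraic_set_def)
  have "V \<union> W = zero_set n {p * q | p q. p \<in> P \<and> q \<in> Q}" (is "_ = zero_set n ?R")
    unfolding PQ(2,4) zero_set_def by (fastforce simp: eval_poly_mult)
  moreover have "?R \<subseteq> polys n"
    using PQ polys_mult by blast
  ultimately show ?thesis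
    using algebraic_set_zero_set by simp
qed

lemma algebraic_set_Union:
  "finite \<V> \<Longrightarrow> (\<And>V. V \<in> \<V> \<Longrightarrow> algebraic_set n V) \<Longrightarrow> algebraic_set n (\<Union>\<V>)"
  by (induction rule: finite_induct) (auto intro: algebraic_set_empty algebraic_set_Un)

lemma zariski_closure_subset: "algebraic_set n V \<Longrightarrow> S \<subseteq> V \<Longrightarrow> zariski_closure n S \<subseteq> V"
  by (auto simp: zariski_closure_def)

lemma subset_zariski_closure: "S \<subseteq> zariski_closure n S"
  by (auto simp: zariski_closure_def)

lemma algebraic_set_zariski_closure:
  assumes "S \<subseteq> topspace (RM n)"
  shows "algebraic_set n (zariski_closure n S)"
proof -
  let ?P = "{p \<in> polys n. \<forall>Y\<in>S. eval_poly p Y = 0}"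
  have "zariski_closure n S = zero_set n ?P"
  proof
    have "S \<subseteq> zero_set n ?P"
      using assms by (auto simp: zero_set_def)
    then show "zariski_closure n S \<subseteq> zero_set n ?P"
      by (intro zariski_closure_subset algebraic_set_zero_set) auto
    show "zero_set n ?P \<subseteq> zariski_closure n S"
      unfolding zariski_closure_def
    proof (intro Inter_greatest, clarify)
      fix V Y assume "algebraic_set n V" "S \<subseteq> V" "Y \<in> zero_set n ?P"
      then show "Y \<in> V"
        unfolding algebraic_set_def zero_set_def by fastforce
    qed
  qed
  then show ?thesis
    using algebraic_set_zero_set[of ?P n] by auto
qed

text \<open>
  The definition of irreducibility only speaks of coverings by two algebraic sets; larger finite
  coverings are reduced to it by splitting off one member at a time.
\<close>

lemma irreducible_set_subset_Union:
  assumes C: "irreducible_set n C" and "finite \<V>" "\<And>V. V \<in> \<V> \<Longrightarrow> algebraic_set n V" "C \<subseteq> \<Union>\<V>"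
  obtains V where "V \<in> \<V>" "C \<subseteq> V"
proof -
  have "\<exists>V\<in>\<V>. C \<subseteq> V"
    using assms(2-4)
  proof (induction rule: finite_induct)
    case empty
    then show ?case
      using C by (simp add: irreducible_set_def)
  next
    case (insert V \<V>)
    have "algebraic_set n C" "algebraic_set n V" "algebraic_set n (\<Union>\<V>)"
      using C insert.prems(1) insert.hyps(1)
      by (simp_all add: irreducible_set_def algebraic_set_Union)
    then have alg: "algebraic_set n (C \<inter> V)" "algebraic_set n (C \<inter> \<Union>\<V>)"
      by (simp_all add: algebraic_set_Int)
    have split: "C = (C \<inter> V) \<union> (C \<inter> \<Union>\<V>)"
      using insert.prems(2) by auto
    have "\<forall>V1 V2. algebraic_set n V1 \<and> algebraic_set n V2 \<and> C = V1 \<union> V2 \<longrightarrow> C = V1 \<or> C = V2"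
      using C by (simp add: irreducible_set_def)
    then have "C = C \<inter> V \<or> C = C \<inter> \<Union>\<V>"
      using alg split by (elim allE[of _ "C \<inter> V"] allE[of _ "C \<inter> \<Union>\<V>"] impE) (rule conjI, assumption, rule conjI)
    then consider "C \<subseteq> V" | "C \<subseteq> \<Union>\<V>"
      by auto
    then show ?case
    proof cases
      case 2
      have "\<exists>W\<in>\<V>. C \<subseteq> W"
        by (rule insert.IH[OF _ 2]) (use insert.prems(1) in simp)
      then show ?thesis
        by simp
    qed simp
  qed
  then show ?thesis
    using that by blast
qed

text \<open>
  An irreducible subset of the union lies in one of the members, so the maximal ones are
  members; a member lies in no larger irreducible subset, since that would again lie in a member.
\<close>

lemma irreducible_components_Union_antichain:
  assumes "finite \<V>" and irr: "\<And>V. V \<in> \<V> \<Longrightarrow> irreducible_set n V"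
    and anti: "\<And>V W. V \<in> \<V> \<Longrightarrow> W \<in> \<V> \<Longrightarrow> V \<subseteq> W \<Longrightarrow> V = W"
  shows "irreducible_components n (\<Union>\<V>) = \<V>"
proof -
  have sub: "\<exists>V\<in>\<V>. C \<subseteq> V" if "irreducible_set n C" "C \<subseteq> \<Union>\<V>" for C
    by (rule irreducible_set_subset_Union[OF that(1) assms(1) _ that(2)])
      (use irr in \<open>auto simp: irreducible_set_def\<close>)
  show ?thesis
  proof (intro equalityI subsetI)
    fix C assume C: "C \<in> irreducible_components n (\<Union>\<V>)"
    then have "irreducible_set n C" "C \<subseteq> \<Union>\<V>"
      by (simp_all add: irreducible_components_def)
    then obtain V where V: "V \<in> \<V>" "C \<subseteq> V"
      using sub by meson
    moreover have "V \<subseteq> \<Union>\<V>"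
      using V(1) by (rule Union_upper)
    ultimately have "V = C"
      using C irr[of V] by (simp add: irreducible_components_def)
    then show "C \<in> \<V>"
      using V by simp
  next
    fix V assume V: "V \<in> \<V>"
    have "C = V" if C: "irreducible_set n C" "V \<subseteq> C" "C \<subseteq> \<Union>\<V>" for C
    proof -
      obtain W where W: "W \<in> \<V>" "C \<subseteq> W"
        using sub[OF C(1,3)] by blast
      then have "V = W"
        using V C(2) by (intro anti) auto
      then show ?thesis
        using W C(2) by simp
    qed
    then show "V \<in> irreducible_components n (\<Union>\<V>)"
      using V irr[of V] by (simp add: irreducible_components_def Union_upper)
  qed
qed

text \<open>
  Restricted to a polynomial curve, a polynomial in many variables becomes one in a single variable,
  where a nonzero polynomial has finitely many roots.
\<close>

lemma eval_poly_curve: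
  fixes \<gamma> :: "pvar \<Rightarrow> real Polynomial.poly"
  shows "\<exists>r. \<forall>t. eval_poly p (\<lambda>v. Polynomial.poly (\<gamma> v) t) = Polynomial.poly r t"
proof
  show "\<forall>t. eval_poly p (\<lambda>v. Polynomial.poly (\<gamma> v) t) =
    Polynomial.poly (\<Sum>m\<in>Poly_Mapping.keys p. Polynomial.smult (Poly_Mapping.lookup p m)
      (\<Prod>v\<in>Poly_Mapping.keys m. \<gamma> v ^ Poly_Mapping.lookup m v)) t"
    by (simp add: eval_poly_def eval_monom_def poly_sum poly_prod)
qed

text \<open>
  A stand-in for "image of an affine space under a polynomial map", which is the usual reason for
  irreducibility: two points of such an image are joined by the image of the line through two of their
  preimages.
\<close>

definition polynomial_curve_connected :: "(pvar \<Rightarrow> real) set \<Rightarrow> bool" where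
  "polynomial_curve_connected V \<longleftrightarrow> (\<forall>Y\<in>V. \<forall>Y'\<in>V. \<exists>\<gamma> :: pvar \<Rightarrow> real Polynomial.poly.
     (\<lambda>v. Polynomial.poly (\<gamma> v) 0) = Y \<and> (\<lambda>v. Polynomial.poly (\<gamma> v) 1) = Y' \<and>
     (\<forall>t. (\<lambda>v. Polynomial.poly (\<gamma> v) t) \<in> V))"

text \<open>
  If \<open>V = V1 \<union> V2\<close> with both parts proper, choose a point of \<open>V\<close> off \<open>V1\<close>, one off \<open>V2\<close>, and a
  curve joining them. An equation of \<open>V1\<close> and one of \<open>V2\<close> are both nonzero on the curve, so at all
  but finitely many parameters neither vanishes, and the curve leaves \<open>V1 \<union> V2\<close>.
\<close>

lemma irreducible_set_if_polynomial_curve_connected: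
  assumes alg: "algebraic_set n V" and "V \<noteq> {}" and conn: "polynomial_curve_connected V"
  shows "irreducible_set n V"
  unfolding irreducible_set_def
proof (intro conjI allI impI; (elim conjE)?)
  fix V1 V2 assume *: "algebraic_set n V1" "algebraic_set n V2" and V: "V = V1 \<union> V2"
  show "V = V1 \<or> V = V2"
  proof (rule ccontr)
    assume "\<not> ?thesis"
    then have "\<not> V \<subseteq> V1" "\<not> V \<subseteq> V2"
      using V by auto
    then obtain A B where AB: "A \<in> V" "A \<notin> V1" "B \<in> V" "B \<notin> V2"
      by (meson subsetI)
    have sub: "V \<subseteq> topspace (RM n)"
      using alg by (auto simp: algebraic_set_def zero_set_def)
    obtain P1 P2 where P: "V1 = zero_set n P1" "V2 = zero_set n P2"
      using * by (auto simp: algebraic_set_def)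
    obtain p1 p2 where p: "p1 \<in> P1" "eval_poly p1 A \<noteq> 0" "p2 \<in> P2" "eval_poly p2 B \<noteq> 0"
      using AB sub unfolding P zero_set_def by blast
    obtain \<gamma> :: "pvar \<Rightarrow> real Polynomial.poly" where \<gamma>: "(\<lambda>v. Polynomial.poly (\<gamma> v) 0) = A" "(\<lambda>v. Polynomial.poly (\<gamma> v) 1) = B"
      "\<And>t. (\<lambda>v. Polynomial.poly (\<gamma> v) t) \<in> V"
      using conn AB unfolding polynomial_curve_connected_def by metis
    obtain r1 r2 where r: "\<And>t. eval_poly p1 (\<lambda>v. Polynomial.poly (\<gamma> v) t) = Polynomial.poly r1 t"
      "\<And>t. eval_poly p2 (\<lambda>v. Polynomial.poly (\<gamma> v) t) = Polynomial.poly r2 t"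
      using eval_poly_curve by metis
    have "r1 \<noteq> 0" "r2 \<noteq> 0"
      using r(1)[of 0] r(2)[of 1] p \<gamma> by auto
    then have "finite {t. Polynomial.poly (r1 * r2) t = 0}"
      by (intro poly_roots_finite) simp
    then obtain t where "Polynomial.poly (r1 * r2) t \<noteq> 0"
      using ex_new_if_finite[OF infinite_UNIV_char_0[where 'a = real]] by blast
    then have "(\<lambda>v. Polynomial.poly (\<gamma> v) t) \<notin> V1 \<union> V2"
      using r p(1,3) unfolding P zero_set_def by fastforce
    then show False
      using \<gamma>(3)[of t] V by simp
  qed
qed (use assms in auto)

section \<open>Maximal minors and kernel vectors\<close>

text \<open>
  All rows of \<open>A(Y)\<close> other than those of player 1 only meet the two columns \<open>(1, k)\<close> and \<open>(2, k)\<close> for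
  a single strategy \<open>k\<close>. Such a row is one linear condition on the two entries \<open>x, y\<close> that a column vector
  has there: \<open>CX\<close> and \<open>CY\<close> come from the identity block and \<open>CE k l\<close> from player 2 comparing \<open>k\<close> and \<open>l\<close>.
\<close>

datatype local_constraint = CX | CY | CE nat nat

fun lc_eval :: "(pvar \<Rightarrow> real) \<Rightarrow> local_constraint \<Rightarrow> real \<Rightarrow> real \<Rightarrow> real" where
  "lc_eval Y CX x y = x"
| "lc_eval Y CY x y = y"
| "lc_eval Y (CE k l) x y = diff2 Y 1 k l * x + diff2 Y 2 k l * y"

lemma lc_eval_linear: "lc_eval Y c x y = x * lc_eval Y c 1 0 + y * lc_eval Y c 0 1"
  by (cases c) (simp_all add: mult.commute)

definition ordered_pairs :: "nat \<Rightarrow> (nat \<times> nat) list" where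
  "ordered_pairs n = [(k, l). k \<leftarrow> [1..<n + 1], l \<leftarrow> [1..<n + 1], k \<noteq> l]"

text \<open>
  Meaningful for rows \<open>i \<ge> 2\<close> only: rows 0 and 1 belong to player 1 and constrain all strategies at once.
\<close>

definition row_label :: "nat \<Rightarrow> nat \<Rightarrow> nat \<times> local_constraint" where
  "row_label n i =
     (if i < 2 + n * (n - 1) then let (k, l) = ordered_pairs n ! (i - 2) in (k, CE k l)
      else let c = i - (2 + n * (n - 1)) in if c < n then (c + 1, CX) else (c - n + 1, CY))"

definition A_entry :: "nat \<Rightarrow> (pvar \<Rightarrow> real) \<Rightarrow> nat \<Rightarrow> nat \<Rightarrow> real" where
  "A_entry n Y i j =
     (if i = 0 then if j < n then Y (Y1 (j + 1)) else 0
      else if i = 1 then if j < n then 0 else - Y (Y1 (j - n + 1))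
      else let (k, c) = row_label n i in
        if j = k - 1 then lc_eval Y c 1 0 else if j = n + k - 1 then lc_eval Y c 0 1 else 0)"

lemma set_ordered_pairs: "set (ordered_pairs n) = {(k, l). k \<in> {1..n} \<and> l \<in> {1..n} \<and> k \<noteq> l}"
  by (auto simp: ordered_pairs_def)

lemma length_ordered_pairs: "length (ordered_pairs n) = n * (n - 1)"
proof -
  have "(\<Sum>l=Suc 0..<Suc n. if k \<noteq> l then 1 else 0) = n - 1" if "k \<in> {1..n}" for k
  proof -
    have "(\<Sum>l=Suc 0..<Suc n. if k \<noteq> l then 1 else (0::nat)) = card ({Suc 0..<Suc n} \<inter> {l. k \<noteq> l})"
      by (subst sum.If_cases) (auto simp del: upt_Suc)
    also have "{Suc 0..<Suc n} \<inter> {l. k \<noteq> l} = {Suc 0..<Suc n} - {k}"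
      by auto
    finally show ?thesis
      using that by simp
  qed
  moreover have "length (ordered_pairs n) =
      (\<Sum>k\<leftarrow>[Suc 0..<Suc n]. \<Sum>l\<leftarrow>[Suc 0..<Suc n]. if k \<noteq> l then 1 else 0)"
    unfolding ordered_pairs_def length_concat map_map comp_def
    by (simp only: length_map if_distrib[of length] list.size One_nat_def add_Suc_right add_0_right add_0)
  ultimately show ?thesis
    by (simp add: interv_sum_list_conv_sum_set_nat del: upt_Suc)
qed

lemma row_label_vertex:
  assumes "2 \<le> i" "i < num_rows n"
  shows "fst (row_label n i) \<in> {1..n}"
proof (cases "i < 2 + n * (n - 1)")
  case True
  then have "ordered_pairs n ! (i - 2) \<in> set (ordered_pairs n)"
    using assms(1) by (intro nth_mem) (simp add: length_ordered_pairs)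
  then show ?thesis
    using True by (auto simp: row_label_def set_ordered_pairs split: prod.split)
next
  case False
  then show ?thesis
    using assms by (auto simp: row_label_def num_rows_def Let_def)
qed

lemma row_label_unit:
  "row_label n (2 + n * (n - 1) + c) = (if c < n then (c + 1, CX) else (c - n + 1, CY))"
  by (simp add: row_label_def Let_def)

lemma basis_vec_index: "c < 2 * n \<Longrightarrow> basis_vec n j k $ c = (if c = (j - 1) * n + (k - 1) then 1 else 0)"
  by (simp add: basis_vec_def unit_vec_def)

lemma row_player1_index:
  assumes "c < 2 * n"
  shows "row_player1 n Y 1 $ c = (if c < n then Y (Y1 (c + 1)) else 0)"
    and "row_player1 n Y 2 $ c = (if c < n then 0 else Y (Y1 (c - n + 1)))"
proof -
  have *: "row_player1 n Y j $ c = (\<Sum>k=1..n. Y (Y1 k) * basis_vec n j k $ c)" for j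
    using assms by (simp add: row_player1_def)
  also have "\<dots> 1 = (\<Sum>k=1..n. if k = c + 1 then Y (Y1 k) else 0)"
    by (rule sum.cong) (use assms in \<open>auto simp: basis_vec_index\<close>)
  finally show "row_player1 n Y 1 $ c = (if c < n then Y (Y1 (c + 1)) else 0)"
    by simp
  have "row_player1 n Y 2 $ c = (\<Sum>k=1..n. if k = c - n + 1 then if c < n then 0 else Y (Y1 k) else 0)"
    unfolding * by (rule sum.cong) (use assms in \<open>auto simp: basis_vec_index\<close>)
  moreover have "c - n + 1 \<in> {1..n} \<or> c < n"
    using assms by auto
  ultimately show "row_player1 n Y 2 $ c = (if c < n then 0 else Y (Y1 (c - n + 1)))"
    by auto
qed

lemma dim_row_player1 [simp]: "dim_vec (row_player1 n Y j) = 2 * n"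
  by (simp add: row_player1_def)

lemma player2_rows:
  "[row_player2 n Y k l. k \<leftarrow> [1..<n + 1], l \<leftarrow> [1..<n + 1], k \<noteq> l] =
   map (\<lambda>(k, l). row_player2 n Y k l) (ordered_pairs n)"
  unfolding ordered_pairs_def map_concat map_map comp_def
  by (simp only: if_distrib[of "map _"] list.map prod.case)

lemma U_mat_eq: "U_mat n Y = mat_of_rows (2 * n) ([row_player1 n Y 1, - row_player1 n Y 2] @
    map (\<lambda>(k, l). row_player2 n Y k l) (ordered_pairs n))"
  unfolding U_mat_def player2_rows ..

lemma A_mat_dims [simp]: "dim_row (A_mat n Y) = num_rows n" "dim_col (A_mat n Y) = 2 * n"
  by (simp_all add: A_mat_def append_rows_def U_mat_eq num_rows_def length_ordered_pairs mat_of_rows_def)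

lemma A_mat_index:
  assumes i: "i < num_rows n" and j: "j < 2 * n"
  shows "A_mat n Y $$ (i, j) = A_entry n Y i j"
proof -
  let ?N = "2 + n * (n - 1)"
  have U: "dim_row (U_mat n Y) = ?N" "dim_col (U_mat n Y) = 2 * n"
    by (simp_all add: U_mat_eq mat_of_rows_def length_ordered_pairs)
  consider "i = 0" | "i = 1" | "2 \<le> i" "i < ?N" | "?N \<le> i"
    by linarith
  then show ?thesis
  proof cases
    case 1
    then show ?thesis
      using j by (simp add: A_mat_def append_rows_def U U_mat_eq mat_of_rows_index A_entry_def row_player1_index[simplified])
  next
    case 2
    then show ?thesis
      using j by (simp add: A_mat_def append_rows_def U U_mat_eq mat_of_rows_index A_entry_def row_player1_index)
  next
    case 3
    obtain k l where kl: "ordered_pairs n ! (i - 2) = (k, l)"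
      by fastforce
    have "(k, l) \<in> set (ordered_pairs n)"
      unfolding kl[symmetric] using 3 by (intro nth_mem) (simp add: length_ordered_pairs)
    then have k: "k \<in> {1..n}"
      by (simp add: set_ordered_pairs)
    have "A_mat n Y $$ (i, j) = U_mat n Y $$ (i, j)"
      using 3 j i by (simp add: A_mat_def append_rows_def U)
    also have "\<dots> = row_player2 n Y k l $ j"
      using 3 j kl by (simp add: U_mat_eq mat_of_rows_index length_ordered_pairs nth_Cons' numeral_2_eq_2)
    also have "\<dots> = diff2 Y 1 k l * basis_vec n 1 k $ j + diff2 Y 2 k l * basis_vec n 2 k $ j"
      using j by (simp add: row_player2_def basis_vec_def)
    also have "\<dots> = A_entry n Y i j"
      using 3 j k kl by (auto simp: A_entry_def row_label_def basis_vec_index)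
    finally show ?thesis .
  next
    case 4
    then obtain c where c: "i = ?N + c"
      using le_Suc_ex by blast
    then have "c < 2 * n"
      using i by (simp add: num_rows_def)
    then have "A_mat n Y $$ (i, j) = (if j = c then 1 else 0)"
      using 4 j i c by (auto simp: A_mat_def append_rows_def U num_rows_def)
    also have "\<dots> = A_entry n Y i j"
      unfolding A_entry_def c row_label_unit using j by auto
    finally show ?thesis .
  qed
qed

lemma pick_image:
  assumes "finite S"
  shows "pick S ` {..<card S} = S"
proof
  show "pick S ` {..<card S} \<subseteq> S"
    by (auto intro: pick_in_set_le)
  show "S \<subseteq> pick S ` {..<card S}"
  proof
    fix i assume "i \<in> S"
    moreover from this have "card {a \<in> S. a < i} < card S"
      using assms by (intro psubset_card_mono) auto
    ultimately show "i \<in> pick S ` {..<card S}"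
      using pick_card_in_set[of i S] by force
  qed
qed

lemma pick_lessThan: "j < m \<Longrightarrow> pick {..<m} j = j"
proof -
  assume "j < m"
  moreover from this have "{a \<in> {..<m}. a < j} = {..<j}"
    by auto
  ultimately show ?thesis
    using pick_card_in_set[of j "{..<m}"] by simp
qed

lemma max_row_setsD:
  assumes "H \<in> max_row_sets n"
  shows "finite H" "card H = 2 * n" "\<And>i. i \<in> H \<Longrightarrow> i < num_rows n"
  using assms finite_subset[of H "{..<num_rows n}"] by (auto simp: max_row_sets_def)

lemma max_minor_eq:
  assumes "H \<in> max_row_sets n"
  shows "max_minor n Y H = det (mat (2 * n) (2 * n) (\<lambda>(r, j). A_entry n Y (pick H r) j))"
proof -
  note H = max_row_setsD[OF assms]
  have "{i. i < num_rows n \<and> i \<in> H} = H" "{j. j < 2 * n \<and> j \<in> {..<2 * n}} = {..<2 * n}"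
    using H(3) by auto
  then have "submatrix (A_mat n Y) H {..<2 * n} =
      mat (2 * n) (2 * n) (\<lambda>(r, j). A_mat n Y $$ (pick H r, pick {..<2 * n} j))"
    by (simp add: submatrix_def H(2))
  also have "\<dots> = mat (2 * n) (2 * n) (\<lambda>(r, j). A_entry n Y (pick H r) j)"
    using H by (intro eq_matI) (auto simp: pick_lessThan A_mat_index pick_in_set_le)
  finally show ?thesis
    by (simp add: max_minor_def minor_def)
qed


lemma sum_columns:
  fixes f :: "nat \<Rightarrow> 'a::comm_monoid_add"
  shows "(\<Sum>j<2 * n. f j) = (\<Sum>k=1..n. f (k - 1)) + (\<Sum>k=1..n. f (n + k - 1))"
proof -
  have "{..<2 * n} = {..<n} \<union> {n..<2 * n}"
    by auto
  then have "(\<Sum>j<2 * n. f j) = (\<Sum>j<n. f j) + (\<Sum>j\<in>{n..<2 * n}. f j)"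
    by (simp add: sum.union_disjoint[symmetric] ivl_disj_int)
  moreover have "(\<Sum>j<n. f j) = (\<Sum>k=1..n. f (k - 1))"
    by (rule sum.reindex_bij_witness[of _ "\<lambda>k. k - 1" Suc]) auto
  moreover have "(\<Sum>j\<in>{n..<2 * n}. f j) = (\<Sum>k=1..n. f (n + k - 1))"
    by (rule sum.reindex_bij_witness[of _ "\<lambda>k. n + k - 1" "\<lambda>j. j - n + 1"]) auto
  ultimately show ?thesis
    by simp
qed

lemma A_entry_mult_vec:
  fixes v :: "nat \<Rightarrow> real"
  shows "(\<Sum>j<2 * n. A_entry n Y 0 j * v j) = (\<Sum>k=1..n. Y (Y1 k) * v (k - 1))"
    and "(\<Sum>j<2 * n. A_entry n Y 1 j * v j) = - (\<Sum>k=1..n. Y (Y1 k) * v (n + k - 1))"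
    and "2 \<le> i \<Longrightarrow> i < num_rows n \<Longrightarrow> (\<Sum>j<2 * n. A_entry n Y i j * v j) =
      (case row_label n i of (k, c) \<Rightarrow> lc_eval Y c (v (k - 1)) (v (n + k - 1)))"
proof -
  have "(\<Sum>k=1..n. A_entry n Y 0 (k - 1) * v (k - 1)) = (\<Sum>k=1..n. Y (Y1 k) * v (k - 1))"
    "(\<Sum>k=1..n. A_entry n Y 0 (n + k - 1) * v (n + k - 1)) = 0"
    by (auto intro!: sum.cong sum.neutral simp: A_entry_def)
  then show "(\<Sum>j<2 * n. A_entry n Y 0 j * v j) = (\<Sum>k=1..n. Y (Y1 k) * v (k - 1))"
    by (simp only: sum_columns add_0_right)
  have "(\<Sum>k=1..n. A_entry n Y 1 (k - 1) * v (k - 1)) = 0"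
    "(\<Sum>k=1..n. A_entry n Y 1 (n + k - 1) * v (n + k - 1)) = (\<Sum>k=1..n. - (Y (Y1 k) * v (n + k - 1)))"
    by (auto intro!: sum.cong sum.neutral simp: A_entry_def)
  then show "(\<Sum>j<2 * n. A_entry n Y 1 j * v j) = - (\<Sum>k=1..n. Y (Y1 k) * v (n + k - 1))"
    by (simp only: sum_columns add_0_left sum_negf)
  assume i: "2 \<le> i" "i < num_rows n"
  obtain k c where kc: "row_label n i = (k, c)"
    by fastforce
  then have k: "k \<in> {1..n}"
    using row_label_vertex[OF i] by simp
  have "(\<Sum>j<2 * n. A_entry n Y i j * v j) =
      (\<Sum>j<2 * n. (if j = k - 1 then lc_eval Y c 1 0 * v j else 0) + (if j = n + k - 1 then lc_eval Y c 0 1 * v j else 0))"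
    by (rule sum.cong) (use i k in \<open>auto simp: A_entry_def kc\<close>)
  also have "\<dots> = lc_eval Y c 1 0 * v (k - 1) + lc_eval Y c 0 1 * v (n + k - 1)"
    using k by (auto simp: sum.distrib)
  also have "\<dots> = lc_eval Y c (v (k - 1)) (v (n + k - 1))"
    by (subst (3) lc_eval_linear) (simp add: mult.commute)
  finally show "(\<Sum>j<2 * n. A_entry n Y i j * v j) =
      (case row_label n i of (k, c) \<Rightarrow> lc_eval Y c (v (k - 1)) (v (n + k - 1)))"
    by (simp add: kc)
qed

text \<open>
  The entry of the column vector at \<open>(1, k)\<close> is \<open>x k\<close> and the one at \<open>(2, k)\<close> is \<open>y k\<close>, for \<open>k\<close> in \<open>{1..n}\<close>.
\<close>

definition kernel_vector ::
  "nat \<Rightarrow> (pvar \<Rightarrow> real) \<Rightarrow> nat set \<Rightarrow> (nat \<Rightarrow> real) \<Rightarrow> (nat \<Rightarrow> real) \<Rightarrow> bool" where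
  "kernel_vector n Y H x y \<longleftrightarrow>
     (\<exists>k\<in>{1..n}. x k \<noteq> 0 \<or> y k \<noteq> 0) \<and>
     (0 \<in> H \<longrightarrow> (\<Sum>k=1..n. Y (Y1 k) * x k) = 0) \<and>
     (1 \<in> H \<longrightarrow> (\<Sum>k=1..n. Y (Y1 k) * y k) = 0) \<and>
     (\<forall>i\<in>H. 2 \<le> i \<longrightarrow> (case row_label n i of (k, c) \<Rightarrow> lc_eval Y c (x k) (y k) = 0))"

lemma kernel_vector_iff:
  assumes H: "\<And>i. i \<in> H \<Longrightarrow> i < num_rows n"
  shows "kernel_vector n Y H (\<lambda>k. v (k - 1)) (\<lambda>k. v (n + k - 1)) \<longleftrightarrow>
    (\<exists>j<2 * n. v j \<noteq> 0) \<and> (\<forall>i\<in>H. (\<Sum>j<2 * n. A_entry n Y i j * v j) = 0)"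
proof -
  have "(\<exists>k\<in>{1..n}. v (k - 1) \<noteq> 0 \<or> v (n + k - 1) \<noteq> 0) \<longleftrightarrow> (\<exists>j<2 * n. v j \<noteq> 0)"
  proof
    assume "\<exists>j<2 * n. v j \<noteq> 0"
    then obtain j where j: "j < 2 * n" "v j \<noteq> 0"
      by auto
    show "\<exists>k\<in>{1..n}. v (k - 1) \<noteq> 0 \<or> v (n + k - 1) \<noteq> 0"
    proof (cases "j < n")
      case True
      then show ?thesis
        using j by (intro bexI[of _ "j + 1"]) auto
    next
      case False
      then show ?thesis
        using j by (intro bexI[of _ "j - n + 1"]) auto
    qed
  next
    assume "\<exists>k\<in>{1..n}. v (k - 1) \<noteq> 0 \<or> v (n + k - 1) \<noteq> 0"
    then obtain k where "k \<in> {1..n}" "v (k - 1) \<noteq> 0 \<or> v (n + k - 1) \<noteq> 0"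
      by auto
    moreover from this have "k - 1 < 2 * n" "n + k - 1 < 2 * n"
      by auto
    ultimately show "\<exists>j<2 * n. v j \<noteq> 0"
      by blast
  qed
  moreover have "(\<forall>i\<in>H. (\<Sum>j<2 * n. A_entry n Y i j * v j) = 0) \<longleftrightarrow>
      (0 \<in> H \<longrightarrow> (\<Sum>j<2 * n. A_entry n Y 0 j * v j) = 0) \<and>
      (1 \<in> H \<longrightarrow> (\<Sum>j<2 * n. A_entry n Y 1 j * v j) = 0) \<and>
      (\<forall>i\<in>H. 2 \<le> i \<longrightarrow> (\<Sum>j<2 * n. A_entry n Y i j * v j) = 0)" (is "?L = ?R")
  proof
    assume R: ?R
    show ?L
    proof
      fix i assume "i \<in> H"
      moreover have "i = 0 \<or> i = 1 \<or> 2 \<le> i"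
        by linarith
      ultimately show "(\<Sum>j<2 * n. A_entry n Y i j * v j) = 0"
        using R by blast
    qed
  qed blast
  moreover have "(\<forall>i\<in>H. 2 \<le> i \<longrightarrow> (\<Sum>j<2 * n. A_entry n Y i j * v j) = 0) \<longleftrightarrow>
      (\<forall>i\<in>H. 2 \<le> i \<longrightarrow> (case row_label n i of (k, c) \<Rightarrow> lc_eval Y c (v (k - 1)) (v (n + k - 1)) = 0))"
    using H by (intro ball_cong) (auto simp: A_entry_mult_vec(3) split: prod.splits)
  ultimately show ?thesis
    unfolding kernel_vector_def A_entry_mult_vec(1,2) by simp
qed

lemma kernel_vector_cong:
  assumes "\<And>k. k \<in> {1..n} \<Longrightarrow> x k = x' k" "\<And>k. k \<in> {1..n} \<Longrightarrow> y k = y' k"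
    and H: "\<And>i. i \<in> H \<Longrightarrow> i < num_rows n"
  shows "kernel_vector n Y H x y \<longleftrightarrow> kernel_vector n Y H x' y'"
proof -
  have "(case row_label n i of (k, c) \<Rightarrow> lc_eval Y c (x k) (y k) = 0) \<longleftrightarrow>
      (case row_label n i of (k, c) \<Rightarrow> lc_eval Y c (x' k) (y' k) = 0)" if "i \<in> H" "2 \<le> i" for i
    using row_label_vertex[OF that(2) H[OF that(1)]] assms(1,2) by (auto split: prod.splits)
  moreover have "(\<Sum>k=1..n. Y (Y1 k) * x k) = (\<Sum>k=1..n. Y (Y1 k) * x' k)"
    "(\<Sum>k=1..n. Y (Y1 k) * y k) = (\<Sum>k=1..n. Y (Y1 k) * y' k)"
    using assms(1,2) by (auto intro: sum.cong)
  moreover have "(\<exists>k\<in>{1..n}. x k \<noteq> 0 \<or> y k \<noteq> 0) \<longleftrightarrow> (\<exists>k\<in>{1..n}. x' k \<noteq> 0 \<or> y' k \<noteq> 0)"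
    using assms(1,2) by (intro bex_cong) auto
  ultimately show ?thesis
    unfolding kernel_vector_def by simp
qed

text \<open>
  Maximal minors enter the proof only through this criterion, their continuity, and their affine
  dependence on a variable that occurs in a single row.
\<close>

lemma max_minor_eq_0_iff_kernel_vector:
  assumes "H \<in> max_row_sets n"
  shows "max_minor n Y H = 0 \<longleftrightarrow> (\<exists>x y. kernel_vector n Y H x y)"
proof -
  note H = max_row_setsD[OF assms]
  define B where "B = mat (2 * n) (2 * n) (\<lambda>(r, j). A_entry n Y (pick H r) j)"
  have B: "B \<in> carrier_mat (2 * n) (2 * n)"
    by (simp add: B_def)
  have zero: "B *\<^sub>v v = 0\<^sub>v (2 * n) \<longleftrightarrow> (\<forall>i\<in>H. (\<Sum>j<2 * n. A_entry n Y i j * v $ j) = 0)"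
    if v: "v \<in> carrier_vec (2 * n)" for v
  proof -
    have "(B *\<^sub>v v) $ r = (\<Sum>j<2 * n. A_entry n Y (pick H r) j * v $ j)" if "r < 2 * n" for r
      using that v by (simp add: B_def scalar_prod_def lessThan_atLeast0)
    then have "B *\<^sub>v v = 0\<^sub>v (2 * n) \<longleftrightarrow>
        (\<forall>r<2 * n. (\<Sum>j<2 * n. A_entry n Y (pick H r) j * v $ j) = 0)"
      using B by (auto simp: vec_eq_iff)
    also have "\<dots> \<longleftrightarrow> (\<forall>i\<in>pick H ` {..<card H}. (\<Sum>j<2 * n. A_entry n Y i j * v $ j) = 0)"
      by (auto simp: H(2))
    finally show ?thesis
      by (simp add: pick_image[OF H(1)])
  qed
  have "max_minor n Y H = 0 \<longleftrightarrow> (\<exists>v. v \<in> carrier_vec (2 * n) \<and> v \<noteq> 0\<^sub>v (2 * n) \<and> B *\<^sub>v v = 0\<^sub>v (2 * n))"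
    using det_0_iff_vec_prod_zero[OF B] by (simp add: max_minor_eq[OF assms] B_def)
  also have "\<dots> \<longleftrightarrow> (\<exists>v. v \<in> carrier_vec (2 * n) \<and>
      kernel_vector n Y H (\<lambda>k. v $ (k - 1)) (\<lambda>k. v $ (n + k - 1)))"
    using zero kernel_vector_iff[OF H(3)] by (auto simp: vec_eq_iff)
  also have "\<dots> \<longleftrightarrow> (\<exists>x y. kernel_vector n Y H x y)"
  proof
    assume "\<exists>x y. kernel_vector n Y H x y"
    then obtain x y where xy: "kernel_vector n Y H x y"
      by blast
    define v where "v = vec (2 * n) (\<lambda>j. if j < n then x (j + 1) else y (j - n + 1))"
    have "kernel_vector n Y H (\<lambda>k. v $ (k - 1)) (\<lambda>k. v $ (n + k - 1)) = kernel_vector n Y H x y"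
      by (rule kernel_vector_cong) (auto simp: v_def H(3))
    then show "\<exists>v. v \<in> carrier_vec (2 * n) \<and>
        kernel_vector n Y H (\<lambda>k. v $ (k - 1)) (\<lambda>k. v $ (n + k - 1))"
      using xy by (intro exI[of _ v]) (auto simp: v_def)
  qed blast
  finally show ?thesis .
qed

definition affine_fun :: "(real \<Rightarrow> real) \<Rightarrow> bool" where
  "affine_fun f \<longleftrightarrow> (\<exists>\<alpha> \<beta>. \<forall>t. f t = \<alpha> + \<beta> * t)"

lemma affine_fun_simps:
  "affine_fun (\<lambda>t. c)"
  "affine_fun (\<lambda>t. t)"
  "affine_fun f \<Longrightarrow> affine_fun (\<lambda>t. - f t)"
  "affine_fun f \<Longrightarrow> affine_fun (\<lambda>t. f t * c)"
  "affine_fun f \<Longrightarrow> affine_fun g \<Longrightarrow> affine_fun (\<lambda>t. f t + g t)"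
proof -
  show "affine_fun (\<lambda>t. c)"
    unfolding affine_fun_def by (intro exI[of _ c] exI[of _ 0]) simp
  show "affine_fun (\<lambda>t. t)"
    unfolding affine_fun_def by (intro exI[of _ 0] exI[of _ 1]) simp
  assume "affine_fun f"
  then obtain \<alpha> \<beta> where f: "\<And>t. f t = \<alpha> + \<beta> * t"
    unfolding affine_fun_def by blast
  show "affine_fun (\<lambda>t. - f t)"
    unfolding affine_fun_def by (intro exI[of _ "- \<alpha>"] exI[of _ "- \<beta>"]) (simp add: f)
  show "affine_fun (\<lambda>t. f t * c)"
    unfolding affine_fun_def by (intro exI[of _ "\<alpha> * c"] exI[of _ "\<beta> * c"]) (simp add: f algebra_simps)
  assume "affine_fun g"
  then obtain \<alpha>' \<beta>' where g: "\<And>t. g t = \<alpha>' + \<beta>' * t"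
    unfolding affine_fun_def by blast
  show "affine_fun (\<lambda>t. f t + g t)"
    unfolding affine_fun_def by (intro exI[of _ "\<alpha> + \<alpha>'"] exI[of _ "\<beta> + \<beta>'"]) (simp add: f g algebra_simps)
qed

lemma affine_fun_sum:
  "finite S \<Longrightarrow> (\<And>i. i \<in> S \<Longrightarrow> affine_fun (f i)) \<Longrightarrow> affine_fun (\<lambda>t. \<Sum>i\<in>S. f i t)"
  by (induction rule: finite_induct) (auto intro: affine_fun_simps)

lemma affine_fun_A_entry: "affine_fun (\<lambda>t. A_entry n (Y(v := t)) i j)"
proof -
  have upd: "affine_fun (\<lambda>t. (Y(v := t)) w)" for w
    by (cases "w = v") (auto intro: affine_fun_simps)
  have "affine_fun (\<lambda>t. diff2 (Y(v := t)) a k l)" for a k l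
    using upd by (cases "k < l") (auto simp: diff2_def intro: affine_fun_simps)
  then have "affine_fun (\<lambda>t. lc_eval (Y(v := t)) c 1 0)" "affine_fun (\<lambda>t. lc_eval (Y(v := t)) c 0 1)" for c
    by (cases c; auto intro: affine_fun_simps)+
  note lc = this
  obtain k c where kc: "row_label n i = (k, c)"
    by fastforce
  consider "i = 0" | "i = 1" | "2 \<le> i"
    by linarith
  then show ?thesis
  proof cases
    case 1
    then show ?thesis
      unfolding A_entry_def using affine_fun_simps(1) upd by (cases "j < n") (simp_all del: fun_upd_apply)
  next
    case 2
    then show ?thesis
      unfolding A_entry_def using affine_fun_simps(1,3) upd by (cases "j < n") (simp_all del: fun_upd_apply)
  next
    case 3
    then show ?thesis
      unfolding A_entry_def kc using affine_fun_simps(1) lc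
      by (cases "j = k - 1"; cases "j = n + k - 1") (simp_all del: fun_upd_apply)
  qed
qed

text \<open>
  Laplace expansion along row \<open>r\<close>: the cofactors omit the only row that involves \<open>v\<close>.
\<close>

lemma affine_fun_max_minor:
  assumes H: "H \<in> max_row_sets n" and "r \<in> H"
    and const: "\<And>i j t. i \<in> H \<Longrightarrow> i \<noteq> r \<Longrightarrow> A_entry n (Y(v := t)) i j = A_entry n Y i j"
  shows "affine_fun (\<lambda>t. max_minor n (Y(v := t)) H)"
proof -
  note HD = max_row_setsD[OF H]
  define B where "B t = mat (2 * n) (2 * n) (\<lambda>(i, j). A_entry n (Y(v := t)) (pick H i) j)" for t
  have B: "B t \<in> carrier_mat (2 * n) (2 * n)" for t
    by (simp add: B_def)
  obtain i where i: "i < 2 * n" "pick H i = r"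
    using pick_image[OF HD(1)] \<open>r \<in> H\<close> HD(2) by force
  have inj: "i' = i" if "i' < 2 * n" "pick H i' = r" for i'
    using card_pick_le[of i H] card_pick_le[of i' H] i that HD(2) by simp
  have cof: "cofactor (B t) i j = cofactor (B 0) i j" if "j < 2 * n" for t j
  proof -
    have "mat_delete (B t) i j = mat_delete (B 0) i j"
    proof (rule eq_matI)
      fix a b assume "a < dim_row (mat_delete (B 0) i j)" "b < dim_col (mat_delete (B 0) i j)"
      then have ab: "a < 2 * n - 1" "b < 2 * n - 1"
        by (simp_all add: mat_delete_def B_def)
      let ?a = "if a < i then a else Suc a" and ?b = "if b < j then b else Suc b"
      have lt: "?a < 2 * n" "?b < 2 * n" "?a \<noteq> i"
        using ab by auto
      then have "pick H ?a \<in> H" "pick H ?a \<noteq> r"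
        using pick_in_set_le[of ?a H] inj[of ?a] HD(2) by auto
      then have "B t $$ (?a, ?b) = B 0 $$ (?a, ?b)"
        using lt const[of "pick H ?a" t ?b] const[of "pick H ?a" 0 ?b] by (simp add: B_def)
      then show "mat_delete (B t) i j $$ (a, b) = mat_delete (B 0) i j $$ (a, b)"
        using ab by (simp add: mat_delete_def B_def)
    qed (simp_all add: mat_delete_def B_def)
    then show ?thesis
      by (simp add: cofactor_def)
  qed
  have "max_minor n (Y(v := t)) H = (\<Sum>j<2 * n. A_entry n (Y(v := t)) r j * cofactor (B 0) i j)" for t
  proof -
    have "max_minor n (Y(v := t)) H = det (B t)"
      by (simp add: max_minor_eq[OF H] B_def)
    also have "\<dots> = (\<Sum>j<2 * n. B t $$ (i, j) * cofactor (B t) i j)"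
      by (rule laplace_expansion_row[OF B i(1)])
    also have "\<dots> = (\<Sum>j<2 * n. A_entry n (Y(v := t)) r j * cofactor (B 0) i j)"
      by (rule sum.cong) (use i cof[of _ t] in \<open>auto simp: B_def\<close>)
    finally show ?thesis .
  qed
  then show ?thesis
    by (simp add: affine_fun_sum affine_fun_simps(4) affine_fun_A_entry)
qed

section \<open>The walls\<close>

definition pairs :: "nat \<Rightarrow> (nat \<times> nat) set" where
  "pairs n = {(k, l). 1 \<le> k \<and> k < l \<and> l \<le> n}"

definition bvar :: "nat \<times> nat \<Rightarrow> pvar" where
  "bvar P = Y2 1 (fst P) (snd P)"

definition cvar :: "nat \<times> nat \<Rightarrow> pvar" where
  "cvar P = Y2 2 (fst P) (snd P)"

lemma var_simps [simp]:
  "bvar P = bvar Q \<longleftrightarrow> P = Q" "cvar P = cvar Q \<longleftrightarrow> P = Q" "bvar P \<noteq> cvar Q" "cvar P \<noteq> bvar Q"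
  "bvar P \<noteq> Y1 k" "cvar P \<noteq> Y1 k" "Y1 k \<noteq> bvar P" "Y1 k \<noteq> cvar P"
  by (auto simp: bvar_def cvar_def prod_eq_iff)

lemma vars_eq: "vars n = Y1 ` {1..n} \<union> bvar ` pairs n \<union> cvar ` pairs n"
proof -
  have "bvar ` pairs n = {Y2 1 k l | k l. 1 \<le> k \<and> k < l \<and> l \<le> n}"
    "cvar ` pairs n = {Y2 2 k l | k l. 1 \<le> k \<and> k < l \<and> l \<le> n}"
    by (auto simp: pairs_def bvar_def cvar_def image_def)
  then show ?thesis
    by (auto simp: vars_def)
qed

lemma var_in_vars [simp]:
  "Y1 k \<in> vars n \<longleftrightarrow> k \<in> {1..n}" "bvar P \<in> vars n \<longleftrightarrow> P \<in> pairs n" "cvar P \<in> vars n \<longleftrightarrow> P \<in> pairs n"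
  by (auto simp: vars_eq)

lemma finite_pairs [simp]: "finite (pairs n)"
  by (rule finite_subset[of _ "{1..n} \<times> {1..n}"]) (auto simp: pairs_def)

lemma finite_vars [simp]: "finite (vars n)"
  by (simp add: vars_eq)

definition var_poly :: "pvar \<Rightarrow> poly_Y" where
  "var_poly v = Poly_Mapping.single (Poly_Mapping.single v 1) 1"

text \<open>
  For two pairs \<open>P\<close> and \<open>Q\<close> of strategies of player 2, the vanishing of this binomial says, for nonzero
  coefficients, that the lines
  \<open>Y (bvar P) x + Y (cvar P) y = 0\<close> and \<open>Y (bvar Q) x + Y (cvar Q) y = 0\<close> in the plane have the same slope.
\<close>

definition slope_binomial :: "nat \<times> nat \<Rightarrow> nat \<times> nat \<Rightarrow> poly_Y" where
  "slope_binomial P Q =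
     Poly_Mapping.single (Poly_Mapping.single (bvar P) 1 + Poly_Mapping.single (cvar Q) 1) 1 +
     Poly_Mapping.single (Poly_Mapping.single (cvar P) 1 + Poly_Mapping.single (bvar Q) 1) (- 1)"

lemma eval_var_poly [simp]: "eval_poly (var_poly v) Y = Y v"
  using eval_monom_single[of v Y] by (simp add: var_poly_def)

lemma eval_slope_binomial [simp]:
  "eval_poly (slope_binomial P Q) Y = Y (bvar P) * Y (cvar Q) - Y (cvar P) * Y (bvar Q)"
  using eval_monom_single[of _ Y] by (simp add: slope_binomial_def eval_poly_add eval_monom_add)

lemma var_poly_polys: "v \<in> vars n \<Longrightarrow> var_poly v \<in> polys n"
  by (simp add: var_poly_def polys_def)

lemma slope_binomial_monomials_distinct:
  assumes "P \<noteq> Q"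
  shows "Poly_Mapping.single (bvar P) 1 + Poly_Mapping.single (cvar Q) 1 \<noteq>
    Poly_Mapping.single (cvar P) (1::nat) + Poly_Mapping.single (bvar Q) 1" (is "?l \<noteq> ?r")
proof
  assume "?l = ?r"
  then have "Poly_Mapping.lookup ?l (bvar P) = Poly_Mapping.lookup ?r (bvar P)"
    by simp
  then show False
    using assms by (simp add: lookup_add lookup_single when_def)
qed

lemma keys_single_add_single:
  assumes "a \<noteq> b" "c \<noteq> 0" "d \<noteq> (0::'a::comm_monoid_add)"
  shows "Poly_Mapping.keys (Poly_Mapping.single a c + Poly_Mapping.single b d) = {a, b}"
proof (rule Set.set_eqI)
  fix x
  show "x \<in> Poly_Mapping.keys (Poly_Mapping.single a c + Poly_Mapping.single b d) \<longleftrightarrow> x \<in> {a, b}"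
    using assms by (cases "x = a"; cases "x = b") (simp_all add: in_keys_iff lookup_add lookup_single)
qed

lemma keys_slope_binomial:
  assumes "P \<noteq> Q"
  shows "Poly_Mapping.keys (slope_binomial P Q) =
    {Poly_Mapping.single (bvar P) 1 + Poly_Mapping.single (cvar Q) 1,
     Poly_Mapping.single (cvar P) 1 + Poly_Mapping.single (bvar Q) 1}"
  unfolding slope_binomial_def
  by (rule keys_single_add_single[OF slope_binomial_monomials_distinct[OF assms]]) simp_all

lemma slope_binomial_polys:
  assumes "P \<in> pairs n" "Q \<in> pairs n" "P \<noteq> Q"
  shows "slope_binomial P Q \<in> polys n"
proof -
  have "Poly_Mapping.keys (Poly_Mapping.single (bvar P) (1::nat) + Poly_Mapping.single (cvar Q) 1) \<subseteq> vars n"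
    "Poly_Mapping.keys (Poly_Mapping.single (cvar P) (1::nat) + Poly_Mapping.single (bvar Q) 1) \<subseteq> vars n"
    using assms by (simp_all add: keys_single_add_single)
  then show ?thesis
    unfolding polys_def mem_Collect_eq keys_slope_binomial[OF assms(3)] by blast
qed

lemma quadratic_binomial_slope_binomial:
  assumes "P \<noteq> Q"
  shows "quadratic_binomial (slope_binomial P Q)"
proof -
  have "monom_degree (Poly_Mapping.single v 1 + Poly_Mapping.single w 1) = 2" if "v \<noteq> w" for v w
    using that by (simp add: monom_degree_def keys_single_add_single lookup_add lookup_single)
  then show ?thesis
    using slope_binomial_monomials_distinct[OF assms]
    by (simp add: quadratic_binomial_def keys_slope_binomial[OF assms] del: One_nat_def)
qed

definition slope_quadric :: "nat \<Rightarrow> nat \<times> nat \<Rightarrow> nat \<times> nat \<Rightarrow> (pvar \<Rightarrow> real) set" where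
  "slope_quadric n P Q = zero_set n {slope_binomial P Q}"

lemma mem_slope_quadric:
  "Y \<in> slope_quadric n P Q \<longleftrightarrow>
     Y \<in> topspace (RM n) \<and> Y (bvar P) * Y (cvar Q) = Y (cvar P) * Y (bvar Q)"
  by (auto simp: slope_quadric_def zero_set_def)

lemma slope_quadric_commute: "slope_quadric n P Q = slope_quadric n Q P"
  by (auto simp: set_eq_iff mem_slope_quadric mult.commute)

lemma coordinate_hyperplane_eq: "coordinate_hyperplane n v = zero_set n {var_poly v}"
  by (simp add: coordinate_hyperplane_def zero_set_def)

lemma mem_coordinate_hyperplane: "Y \<in> coordinate_hyperplane n v \<longleftrightarrow> Y \<in> topspace (RM n) \<and> Y v = 0"
  by (simp add: coordinate_hyperplane_def)

definition walls :: "nat \<Rightarrow> (pvar \<Rightarrow> real) set set" where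
  "walls n = {coordinate_hyperplane n v | v. v \<in> vars n} \<union>
     {slope_quadric n P Q | P Q. P \<in> pairs n \<and> Q \<in> pairs n \<and> P \<noteq> Q}"

lemma wall_cases [consumes 1, case_names hyperplane quadric]:
  assumes "V \<in> walls n"
  obtains v where "v \<in> vars n" "V = coordinate_hyperplane n v"
  | P Q where "P \<in> pairs n" "Q \<in> pairs n" "P \<noteq> Q" "V = slope_quadric n P Q"
  using assms by (auto simp: walls_def)

lemma finite_walls: "finite (walls n)"
proof -
  have "walls n \<subseteq> coordinate_hyperplane n ` vars n \<union> (\<lambda>(P, Q). slope_quadric n P Q) ` (pairs n \<times> pairs n)"
    by (auto simp: walls_def)
  then show ?thesis
    by (rule finite_subset) simp
qed

lemma wall_eq_zero_set:
  assumes "V \<in> walls n"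
  shows "\<exists>p\<in>polys n. V = zero_set n {p}"
  using assms
proof (cases rule: wall_cases)
  case (hyperplane v)
  then show ?thesis
    using var_poly_polys coordinate_hyperplane_eq by blast
next
  case (quadric P Q)
  then show ?thesis
    using slope_binomial_polys slope_quadric_def by blast
qed

lemma algebraic_set_wall:
  assumes "V \<in> walls n"
  shows "algebraic_set n V"
proof -
  obtain p where "p \<in> polys n" "V = zero_set n {p}"
    using wall_eq_zero_set[OF assms] by blast
  then show ?thesis
    using algebraic_set_zero_set[of "{p}" n] by simp
qed

lemma walls_subset_topspace:
  assumes "V \<in> walls n"
  shows "V \<subseteq> topspace (RM n)"
  using wall_eq_zero_set[OF assms] by (auto simp: zero_set_def)

lemma polynomial_curve_connected_hyperplane:
  "polynomial_curve_connected (coordinate_hyperplane n v)"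
  unfolding polynomial_curve_connected_def
proof (intro ballI)
  fix Y Y' assume Y: "Y \<in> coordinate_hyperplane n v" "Y' \<in> coordinate_hyperplane n v"
  define \<gamma> where "\<gamma> w = [:Y w, Y' w - Y w:]" for w
  have "(\<lambda>w. Polynomial.poly (\<gamma> w) 0) = Y" "(\<lambda>w. Polynomial.poly (\<gamma> w) 1) = Y'"
    by (simp_all add: \<gamma>_def)
  moreover have "(\<lambda>w. Polynomial.poly (\<gamma> w) t) \<in> coordinate_hyperplane n v" for t
    using Y by (auto simp: mem_coordinate_hyperplane topspace_RM extensional_def \<gamma>_def)
  ultimately show "\<exists>\<gamma>. (\<lambda>v. Polynomial.poly (\<gamma> v) 0) = Y \<and> (\<lambda>v. Polynomial.poly (\<gamma> v) 1) = Y' \<and>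
      (\<forall>t. (\<lambda>v. Polynomial.poly (\<gamma> v) t) \<in> coordinate_hyperplane n v)"
    by blast
qed

text \<open>
  This parametrizes the quadric: a singular \<open>2 \<times> 2\<close> matrix is the product of a column and a row. The
  factors, unlike points of the quadric, can be interpolated linearly.
\<close>

lemma rank_one_factorization:
  fixes b c b' c' :: real
  assumes "b * c' = c * b'"
  shows "\<exists>s t p q. b = s * p \<and> c = s * q \<and> b' = t * p \<and> c' = t * q"
proof -
  consider "b = 0" "c = 0" | "b \<noteq> 0" | "b = 0" "c \<noteq> 0"
    by blast
  then show ?thesis
  proof cases
    case 1
    then show ?thesis
      by (intro exI[of _ 0] exI[of _ 1] exI[of _ b'] exI[of _ c']) simp
  next
    case 2
    then show ?thesis
      using assms by (intro exI[of _ 1] exI[of _ "b' / b"] exI[of _ b] exI[of _ c]) (simp add: field_simps)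
  next
    case 3
    then show ?thesis
      using assms by (intro exI[of _ 1] exI[of _ "c' / c"] exI[of _ b] exI[of _ c]) (simp add: field_simps)
  qed
qed

lemma polynomial_curve_connected_slope_quadric:
  assumes "P \<in> pairs n" "Q \<in> pairs n" "P \<noteq> Q"
  shows "polynomial_curve_connected (slope_quadric n P Q)"
  unfolding polynomial_curve_connected_def
proof (intro ballI)
  fix Y Y' assume Y: "Y \<in> slope_quadric n P Q" "Y' \<in> slope_quadric n P Q"
  have fact: "\<exists>s t p q. Z (bvar P) = s * p \<and> Z (cvar P) = s * q \<and> Z (bvar Q) = t * p \<and> Z (cvar Q) = t * q"
    if "Z \<in> slope_quadric n P Q" for Z
    using that by (intro rank_one_factorization) (simp add: mem_slope_quadric)
  obtain s t p q where 1: "Y (bvar P) = s * p" "Y (cvar P) = s * q" "Y (bvar Q) = t * p" "Y (cvar Q) = t * q"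
    using fact[OF Y(1)] by metis
  obtain s' t' p' q' where 2: "Y' (bvar P) = s' * p'" "Y' (cvar P) = s' * q'"
      "Y' (bvar Q) = t' * p'" "Y' (cvar Q) = t' * q'"
    using fact[OF Y(2)] by metis
  define \<gamma> where "\<gamma> w =
    (if w = bvar P then [:s, s' - s:] * [:p, p' - p:]
     else if w = cvar P then [:s, s' - s:] * [:q, q' - q:]
     else if w = bvar Q then [:t, t' - t:] * [:p, p' - p:]
     else if w = cvar Q then [:t, t' - t:] * [:q, q' - q:]
     else [:Y w, Y' w - Y w:])" for w
  have "(\<lambda>w. Polynomial.poly (\<gamma> w) 0) = Y" "(\<lambda>w. Polynomial.poly (\<gamma> w) 1) = Y'"
    using 1 2 by (auto simp: \<gamma>_def fun_eq_iff simp del: mult_pCons_left mult_pCons_right)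
  moreover have "(\<lambda>w. Polynomial.poly (\<gamma> w) r) \<in> slope_quadric n P Q" for r
  proof -
    have "w \<noteq> bvar P \<and> w \<noteq> cvar P \<and> w \<noteq> bvar Q \<and> w \<noteq> cvar Q" if "w \<notin> vars n" for w
      using that assms by (auto simp: vars_eq)
    then have "(\<lambda>w. Polynomial.poly (\<gamma> w) r) \<in> topspace (RM n)"
      using Y by (simp add: mem_slope_quadric topspace_RM extensional_def \<gamma>_def)
    then show ?thesis
      using assms(3)
      by (simp add: mem_slope_quadric \<gamma>_def mult_ac del: mult_pCons_left mult_pCons_right poly_pCons)
  qed
  ultimately show "\<exists>\<gamma>. (\<lambda>v. Polynomial.poly (\<gamma> v) 0) = Y \<and> (\<lambda>v. Polynomial.poly (\<gamma> v) 1) = Y' \<and>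
      (\<forall>t. (\<lambda>v. Polynomial.poly (\<gamma> v) t) \<in> slope_quadric n P Q)"
    by blast
qed

lemma wall_nonempty: "V \<in> walls n \<Longrightarrow> V \<noteq> {}"
proof -
  assume "V \<in> walls n"
  then have "restrict (\<lambda>_. 0) (vars n) \<in> V"
  proof (cases rule: wall_cases)
    case (hyperplane v)
    then show ?thesis
      by (simp add: mem_coordinate_hyperplane topspace_RM)
  next
    case (quadric P Q)
    then show ?thesis
      by (simp add: mem_slope_quadric topspace_RM)
  qed
  then show "V \<noteq> {}"
    by blast
qed

lemma irreducible_set_wall:
  assumes "V \<in> walls n"
  shows "irreducible_set n V"
proof (rule irreducible_set_if_polynomial_curve_connected)
  show "algebraic_set n V" "V \<noteq> {}"
    using assms by (simp_all add: algebraic_set_wall wall_nonempty)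
  show "polynomial_curve_connected V"
    using assms by (cases rule: wall_cases)
      (simp_all add: polynomial_curve_connected_hyperplane polynomial_curve_connected_slope_quadric)
qed

text \<open>
  The separating points are obtained from the point with all coordinates 1, which lies on every quadric and on no
  hyperplane. Setting one coordinate to 0 moves it to a hyperplane, and setting a coordinate
  of the pair \<open>R\<close> to 2 moves it off exactly the quadrics that involve \<open>R\<close>.
\<close>

lemma walls_antichain:
  assumes "V \<in> walls n" "W \<in> walls n" "V \<subseteq> W"
  shows "V = W"
proof (rule ccontr)
  assume "V \<noteq> W"
  define pt where "pt f = restrict f (vars n)" for f :: "pvar \<Rightarrow> real"
  have pt: "pt f \<in> topspace (RM n)" and ptv: "v \<in> vars n \<Longrightarrow> pt f v = f v" for f v
    by (simp_all add: pt_def topspace_RM)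
  have ptb: "P \<in> pairs n \<Longrightarrow> pt f (bvar P) = f (bvar P)" "P \<in> pairs n \<Longrightarrow> pt f (cvar P) = f (cvar P)" for f P
    by (simp_all add: ptv)
  have "\<exists>Y. Y \<in> V \<and> Y \<notin> W"
    using assms(1)
  proof (cases rule: wall_cases)
    case v: (hyperplane v)
    let ?f = "(\<lambda>_. 1)(v := 0) :: pvar \<Rightarrow> real"
    have in_V: "pt f \<in> V" if "f v = 0" for f
      using that v by (simp add: mem_coordinate_hyperplane pt ptv)
    show ?thesis
      using assms(2)
    proof (cases rule: wall_cases)
      case (hyperplane w)
      then have "w \<noteq> v"
        using v(2) \<open>V \<noteq> W\<close> by metis
      then have "pt ?f \<notin> W"
        using hyperplane by (simp add: mem_coordinate_hyperplane ptv)
      then show ?thesis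
        using in_V[of ?f] by force
    next
      case (quadric P Q)
      show ?thesis
      proof (cases "v \<in> {bvar P, cvar P, bvar Q, cvar Q}")
        case True
        then have "pt ?f \<notin> W"
          using quadric by (auto simp: mem_slope_quadric ptb)
        then show ?thesis
          using in_V[of ?f] by force
      next
        case False
        let ?g = "?f(bvar P := 2)"
        have "pt ?g \<notin> W"
          using False quadric by (auto simp: mem_slope_quadric ptb)
        then show ?thesis
          using in_V[of ?g] False by force
      qed
    qed
  next
    case PQ: (quadric P Q)
    show ?thesis
      using assms(2)
    proof (cases rule: wall_cases)
      case (hyperplane w)
      let ?f = "\<lambda>_. 1 :: real"
      have "pt ?f \<in> V" "pt ?f \<notin> W"
        using PQ hyperplane by (simp_all add: mem_slope_quadric mem_coordinate_hyperplane pt ptv ptb)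
      then show ?thesis
        by blast
    next
      case (quadric P' Q')
      have "\<not> (P' \<in> {P, Q} \<and> Q' \<in> {P, Q})"
      proof
        assume "P' \<in> {P, Q} \<and> Q' \<in> {P, Q}"
        then have "P' = P \<and> Q' = Q \<or> P' = Q \<and> Q' = P"
          using quadric(3) by blast
        then have "V = W"
          using PQ(4) quadric(4) slope_quadric_commute[of n P Q] by metis
        then show False
          using \<open>V \<noteq> W\<close> by simp
      qed
      then obtain R where R: "R = P' \<or> R = Q'" "R \<noteq> P" "R \<noteq> Q"
        by blast
      let ?f = "(\<lambda>_. 1 :: real)(bvar R := 2)"
      have "pt ?f \<in> V"
        using PQ R(2,3) by (simp add: mem_slope_quadric pt ptb)
      moreover have "pt ?f \<notin> W"
        using R(1) quadric by (auto simp: mem_slope_quadric ptb)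
      ultimately show ?thesis
        by blast
    qed
  qed
  then show False
    using assms(3) by blast
qed

section \<open>The matroid is constant off the walls\<close>

definition generic :: "nat \<Rightarrow> (pvar \<Rightarrow> real) \<Rightarrow> bool" where
  "generic n Y \<longleftrightarrow> Y \<in> topspace (RM n) \<and> Y \<notin> \<Union>(walls n)"

lemma genericD:
  assumes "generic n Y"
  shows "Y \<in> topspace (RM n)"
    and "\<And>v. v \<in> vars n \<Longrightarrow> Y v \<noteq> 0"
    and "\<And>P Q. P \<in> pairs n \<Longrightarrow> Q \<in> pairs n \<Longrightarrow> P \<noteq> Q \<Longrightarrow>
      Y (bvar P) * Y (cvar Q) \<noteq> Y (cvar P) * Y (bvar Q)"
proof -
  show Y: "Y \<in> topspace (RM n)"
    using assms by (simp add: generic_def)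
  show "Y v \<noteq> 0" if "v \<in> vars n" for v
  proof
    assume "Y v = 0"
    then have "Y \<in> coordinate_hyperplane n v"
      using Y by (simp add: mem_coordinate_hyperplane)
    moreover have "coordinate_hyperplane n v \<in> walls n"
      unfolding walls_def using that by blast
    ultimately show False
      using assms by (auto simp: generic_def)
  qed
  show "Y (bvar P) * Y (cvar Q) \<noteq> Y (cvar P) * Y (bvar Q)"
    if "P \<in> pairs n" "Q \<in> pairs n" "P \<noteq> Q" for P Q
  proof
    assume "Y (bvar P) * Y (cvar Q) = Y (cvar P) * Y (bvar Q)"
    then have "Y \<in> slope_quadric n P Q"
      using Y by (simp add: mem_slope_quadric)
    moreover have "slope_quadric n P Q \<in> walls n"
      unfolding walls_def using that by blast
    ultimately show False
      using assms by (auto simp: generic_def)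
  qed
qed

definition sorted_pair :: "nat \<Rightarrow> nat \<Rightarrow> nat \<times> nat" where
  "sorted_pair k l = (if k < l then (k, l) else (l, k))"

lemma lc_eval_CE:
  "lc_eval Y (CE k l) x y = (if k < l then 1 else - 1) *
     (Y (bvar (sorted_pair k l)) * x + Y (cvar (sorted_pair k l)) * y)"
  by (simp add: diff2_def sorted_pair_def bvar_def cvar_def)

declare lc_eval.simps(3) [simp del]

lemma lc_eval_CE_eq_0_iff:
  "lc_eval Y (CE k l) x y = 0 \<longleftrightarrow> Y (bvar (sorted_pair k l)) * x + Y (cvar (sorted_pair k l)) * y = 0"
  unfolding lc_eval_CE by simp

fun proper_constraint :: "nat \<Rightarrow> local_constraint \<Rightarrow> bool" where
  "proper_constraint n (CE k l) \<longleftrightarrow> sorted_pair k l \<in> pairs n"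
| "proper_constraint n _ \<longleftrightarrow> True"

lemma ordered_pairs_nth:
  assumes "i < n * (n - 1)"
  shows "ordered_pairs n ! i \<in> {(k, l). k \<in> {1..n} \<and> l \<in> {1..n} \<and> k \<noteq> l}"
  unfolding set_ordered_pairs[symmetric] by (rule nth_mem) (use assms in \<open>simp add: length_ordered_pairs\<close>)

lemma proper_constraint_row_label:
  assumes "2 \<le> i" "i < num_rows n" "row_label n i = (k, c)"
  shows "proper_constraint n c"
proof (cases "i < 2 + n * (n - 1)")
  case True
  obtain k' l where kl: "ordered_pairs n ! (i - 2) = (k', l)"
    by fastforce
  then have "k' \<in> {1..n}" "l \<in> {1..n}" "k' \<noteq> l"
    using ordered_pairs_nth[of "i - 2" n] True assms(1) by auto
  moreover have "c = CE k' l"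
    using True kl assms(3) by (auto simp: row_label_def)
  ultimately show ?thesis
    by (auto simp: sorted_pair_def pairs_def)
next
  case False
  then have "c = CX \<or> c = CY"
    using assms(3) by (auto simp: row_label_def Let_def split: if_splits)
  then show ?thesis
    by auto
qed

text \<open>
  Off the walls the lines \<open>x = 0\<close>, \<open>y = 0\<close> and those belonging to different pairs are pairwise
  distinct, because neither the variables nor the slope binomials vanish. Constraints with a common
  nonzero solution therefore describe the same line, and they do so for every choice of the payoffs.
  This covers \<open>CE k l\<close> and \<open>CE l k\<close>, which belong to different strategies but are proportional.
\<close>

lemma common_solution_imp_same_constraint:
  assumes Y: "generic n Y" and c: "proper_constraint n c" "proper_constraint n c'"
    and nz: "x \<noteq> 0 \<or> y \<noteq> 0" and sol: "lc_eval Y c x y = 0" "lc_eval Y c' x y = 0"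
  shows "lc_eval Y' c x' y' = 0 \<longleftrightarrow> lc_eval Y' c' x' y' = 0"
proof -
  have *: "x \<noteq> 0 \<and> y \<noteq> 0" if "proper_constraint n (CE k l)" "lc_eval Y (CE k l) x y = 0" for k l
    using that nz genericD(2)[OF Y, of "bvar (sorted_pair k l)"] genericD(2)[OF Y, of "cvar (sorted_pair k l)"]
    by (auto simp: lc_eval_CE_eq_0_iff)
  consider "c = c'" | "c = CX" "c' = CY" | "c = CY" "c' = CX"
    | k l where "c = CE k l" "c' = CX \<or> c' = CY" | k l where "c' = CE k l" "c = CX \<or> c = CY"
    | k l k' l' where "c = CE k l" "c' = CE k' l'"
    by (cases c; cases c'; simp)
  then show ?thesis
  proof cases
    case (4 k l)
    then show ?thesis
      using *[of k l] c sol by auto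
  next
    case (5 k l)
    then show ?thesis
      using *[of k l] c sol by auto
  next
    case (6 k l k' l')
    let ?P = "sorted_pair k l" and ?Q = "sorted_pair k' l'"
    have "Y (bvar ?P) * x + Y (cvar ?P) * y = 0" "Y (bvar ?Q) * x + Y (cvar ?Q) * y = 0"
      using 6 sol by (simp_all add: lc_eval_CE_eq_0_iff)
    moreover have "(Y (bvar ?P) * Y (cvar ?Q) - Y (cvar ?P) * Y (bvar ?Q)) * x =
        (Y (bvar ?P) * x + Y (cvar ?P) * y) * Y (cvar ?Q) - (Y (bvar ?Q) * x + Y (cvar ?Q) * y) * Y (cvar ?P)"
      by (simp add: algebra_simps)
    ultimately have "(Y (bvar ?P) * Y (cvar ?Q) - Y (cvar ?P) * Y (bvar ?Q)) * x = 0"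
      by simp
    moreover have "x \<noteq> 0"
      using *[of k l] 6 c sol by simp
    ultimately have "Y (bvar ?P) * Y (cvar ?Q) = Y (cvar ?P) * Y (bvar ?Q)"
      by simp
    then have "?P = ?Q"
      using genericD(3)[OF Y, of ?P ?Q] c 6 by auto
    then show ?thesis
      using 6 by (simp add: lc_eval_CE_eq_0_iff)
  qed (use nz sol in auto)
qed

lemma lc_eval_has_solution: "\<exists>x y. (x \<noteq> 0 \<or> y \<noteq> 0) \<and> lc_eval Y c x y = 0"
proof (cases "lc_eval Y c 0 1 = 0")
  case True
  then show ?thesis
    by (intro exI[of _ 0] exI[of _ 1]) simp
next
  case False
  then show ?thesis
    by (intro exI[of _ "lc_eval Y c 0 1"] exI[of _ "- lc_eval Y c 1 0"]) (simp add: lc_eval_linear[of Y c "lc_eval Y c 0 1"])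
qed

lemma common_solution_transfer:
  assumes Y: "generic n Y" and T: "\<And>c. c \<in> T \<Longrightarrow> proper_constraint n c"
    and nz: "x \<noteq> 0 \<or> y \<noteq> 0" and sol: "\<And>c. c \<in> T \<Longrightarrow> lc_eval Y c x y = 0"
  shows "\<exists>x' y'. (x' \<noteq> 0 \<or> y' \<noteq> 0) \<and> (\<forall>c\<in>T. lc_eval Y' c x' y' = 0)"
proof (cases "T = {}")
  case True
  then show ?thesis
    by (intro exI[of _ 1] exI) simp
next
  case False
  then obtain c where c: "c \<in> T"
    by blast
  obtain x' y' where xy: "x' \<noteq> 0 \<or> y' \<noteq> 0" "lc_eval Y' c x' y' = 0"
    using lc_eval_has_solution by blast
  have "lc_eval Y' c' x' y' = 0" if "c' \<in> T" for c'
    using common_solution_imp_same_constraint[OF Y T[OF c] T[OF that] nz sol[OF c] sol[OF that]] xy(2) by blast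
  then show ?thesis
    using xy(1) by blast
qed

lemma one_equation_nontrivial:
  fixes f :: "'a \<Rightarrow> real"
  assumes "finite S" "2 \<le> card S"
  shows "\<exists>t. (\<exists>k\<in>S. t k \<noteq> 0) \<and> (\<Sum>k\<in>S. t k * f k) = 0"
proof -
  obtain a b where ab: "a \<in> S" "b \<in> S" "a \<noteq> b"
    using assms by (metis One_nat_def Suc_1 card_le_Suc0_iff_eq not_less_eq_eq)
  define t where "t k = (if k = a then if f a = 0 then 1 else f b else if k = b then if f a = 0 then 0 else - f a else 0)" for k
  have "(\<Sum>k\<in>S. t k * f k) = (\<Sum>k\<in>{a, b}. t k * f k)"
    by (rule sum.mono_neutral_right) (use assms ab in \<open>auto simp: t_def\<close>)
  also have "\<dots> = 0"
    using ab by (simp add: t_def)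
  finally have "(\<Sum>k\<in>S. t k * f k) = 0" .
  moreover have "t a \<noteq> 0 \<or> t b \<noteq> 0"
    using ab(3) by (simp add: t_def)
  ultimately show ?thesis
    using ab by blast
qed

text \<open>
  Some unknown \<open>a\<close> with a nonzero coefficient in the first equation is eliminated; what remains is one
  equation in the other unknowns.
\<close>

lemma two_equations_nontrivial:
  fixes f g :: "'a \<Rightarrow> real"
  assumes S: "finite S" "3 \<le> card S"
  shows "\<exists>t. (\<exists>k\<in>S. t k \<noteq> 0) \<and> (\<Sum>k\<in>S. t k * f k) = 0 \<and> (\<Sum>k\<in>S. t k * g k) = 0"
proof (cases "\<forall>k\<in>S. f k = 0")
  case True
  then show ?thesis
    using one_equation_nontrivial[of S g] S by simp
next
  case False
  then obtain a where a: "a \<in> S" "f a \<noteq> 0"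
    by blast
  let ?S = "S - {a}"
  have "finite ?S" "2 \<le> card ?S"
    using S a by simp_all
  then obtain t where t: "\<exists>k\<in>?S. t k \<noteq> 0" "(\<Sum>k\<in>?S. t k * (g k - g a * f k / f a)) = 0"
    using one_equation_nontrivial[of ?S "\<lambda>k. g k - g a * f k / f a"] by blast
  define F where "F = (\<Sum>k\<in>?S. t k * f k)"
  \<comment> \<open>The value at \<open>a\<close> is chosen to satisfy the first equation.\<close>
  define s where "s = t(a := - F / f a)"
  have s: "(\<Sum>k\<in>S. s k * h k) = - F / f a * h a + (\<Sum>k\<in>?S. t k * h k)" for h
    using S(1) a(1) by (simp add: s_def sum.remove[of S a])
  have "(\<Sum>k\<in>S. s k * f k) = 0"
    unfolding s using a(2) by (simp add: F_def)
  moreover have "(\<Sum>k\<in>?S. t k * (g k - g a * f k / f a)) = (\<Sum>k\<in>?S. t k * g k) - F / f a * g a"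
    unfolding F_def by (simp add: right_diff_distrib sum_subtractf sum_distrib_left sum_divide_distrib mult_ac)
  then have "(\<Sum>k\<in>S. s k * g k) = 0"
    unfolding s using t(2) by simp
  moreover have "\<exists>k\<in>S. s k \<noteq> 0"
    using t(1) by (auto simp: s_def)
  ultimately show ?thesis
    by blast
qed

text \<open>
  The matroid of the rows of \<open>A(Y)\<close> is the same for all generic \<open>Y\<close>. Let \<open>S\<close> be the set of strategies at which
  a kernel vector for \<open>Y\<close> is nonzero. At each of them the local constraints have a common nonzero solution, also
  for \<open>Y'\<close>, and these solutions can be scaled independently. It remains to satisfy the at most two rows of
  player 1. With more strategies than such rows this is a dimension count. Otherwise \<open>S\<close> has one
  element and the rows of player 1 amount to local constraints, or it has two elements and both rows force
  the two parts of the kernel vector to be proportional, so that all local constraints share a solution.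
\<close>

lemma kernel_vector_transfer:
  assumes Y: "generic n Y" and H: "\<And>i. i \<in> H \<Longrightarrow> i < num_rows n" and ker: "kernel_vector n Y H x y"
  shows "\<exists>x' y'. kernel_vector n Y' H x' y'"
proof -
  define S where "S = {k \<in> {1..n}. x k \<noteq> 0 \<or> y k \<noteq> 0}"
  have S: "finite S" "S \<subseteq> {1..n}" "S \<noteq> {}"
    using ker by (auto simp: S_def kernel_vector_def)
  define T where "T k = {c. \<exists>i\<in>H. 2 \<le> i \<and> row_label n i = (k, c)}" for k
  have T: "proper_constraint n c" "lc_eval Y c (x k) (y k) = 0" if "c \<in> T k" for c k
    using that H ker proper_constraint_row_label by (force simp: T_def kernel_vector_def)+
  have sumS: "(\<Sum>k=1..n. Y (Y1 k) * x k) = (\<Sum>k\<in>S. Y (Y1 k) * x k)"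
    "(\<Sum>k=1..n. Y (Y1 k) * y k) = (\<Sum>k\<in>S. Y (Y1 k) * y k)"
    by (rule sum.mono_neutral_right; auto simp: S_def)+
  have global: "0 \<in> H \<Longrightarrow> (\<Sum>k\<in>S. Y (Y1 k) * x k) = 0" "1 \<in> H \<Longrightarrow> (\<Sum>k\<in>S. Y (Y1 k) * y k) = 0"
    using ker unfolding kernel_vector_def sumS by simp_all
  \<comment> \<open>Scaling local solutions for \<open>Y'\<close> keeps all local constraints, so only the two global equations remain.\<close>
  have build: "\<exists>x' y'. kernel_vector n Y' H x' y'"
    if pq: "\<And>k. k \<in> S \<Longrightarrow> p k \<noteq> 0 \<or> q k \<noteq> 0" "\<And>k c. k \<in> S \<Longrightarrow> c \<in> T k \<Longrightarrow> lc_eval Y' c (p k) (q k) = 0"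
      and t: "\<exists>k\<in>S. t k \<noteq> 0" "0 \<in> H \<Longrightarrow> (\<Sum>k\<in>S. t k * (Y' (Y1 k) * p k)) = 0"
        "1 \<in> H \<Longrightarrow> (\<Sum>k\<in>S. t k * (Y' (Y1 k) * q k)) = 0" for p q t :: "nat \<Rightarrow> real"
  proof -
    define x' y' where "x' k = (if k \<in> S then t k * p k else 0)" "y' k = (if k \<in> S then t k * q k else 0)" for k
    have "(\<Sum>k=1..n. Y' (Y1 k) * x' k) = (\<Sum>k\<in>S. t k * (Y' (Y1 k) * p k))"
      "(\<Sum>k=1..n. Y' (Y1 k) * y' k) = (\<Sum>k\<in>S. t k * (Y' (Y1 k) * q k))"
      by (rule sum.mono_neutral_cong_right; use S in \<open>auto simp: x'_y'_def\<close>)+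
    moreover have "\<exists>k\<in>{1..n}. x' k \<noteq> 0 \<or> y' k \<noteq> 0"
    proof -
      obtain k where "k \<in> S" "t k \<noteq> 0"
        using t(1) by blast
      then show ?thesis
        using S(2) pq(1)[of k] by (intro bexI[of _ k]) (auto simp: x'_y'_def)
    qed
    moreover have "case row_label n i of (k, c) \<Rightarrow> lc_eval Y' c (x' k) (y' k) = 0" if i: "i \<in> H" "2 \<le> i" for i
    proof -
      obtain k c where kc: "row_label n i = (k, c)"
        by fastforce
      have "lc_eval Y' c (x' k) (y' k) = 0"
      proof (cases "k \<in> S")
        case True
        have "lc_eval Y' c (p k) (q k) = 0"
          using pq(2)[OF True, of c] i kc by (auto simp: T_def)
        then have "t k * (p k * lc_eval Y' c 1 0 + q k * lc_eval Y' c 0 1) = 0"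
          by (simp add: lc_eval_linear[of Y' c "p k"])
        then show ?thesis
          using True by (simp add: lc_eval_linear[of Y' c "t k * p k"] x'_y'_def distrib_left mult.assoc)
      next
        case False
        then show ?thesis
          using lc_eval_linear[of Y' c 0 0] by (simp add: x'_y'_def)
      qed
      then show ?thesis
        by (simp add: kc)
    qed
    ultimately have "kernel_vector n Y' H x' y'"
      using t(2,3) by (simp add: kernel_vector_def)
    then show ?thesis
      by blast
  qed
  have Snz: "x k \<noteq> 0 \<or> y k \<noteq> 0" if "k \<in> S" for k
    using that by (simp add: S_def)
  have "\<forall>k\<in>S. \<exists>p q. (p \<noteq> 0 \<or> q \<noteq> 0) \<and> (\<forall>c\<in>T k. lc_eval Y' c p q = 0)"
  proof
    fix k assume "k \<in> S"
    show "\<exists>p q. (p \<noteq> 0 \<or> q \<noteq> 0) \<and> (\<forall>c\<in>T k. lc_eval Y' c p q = 0)"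
      by (rule common_solution_transfer[OF Y T(1) Snz[OF \<open>k \<in> S\<close>] T(2)])
  qed
  then obtain p q where pq: "\<And>k. k \<in> S \<Longrightarrow> p k \<noteq> 0 \<or> q k \<noteq> 0"
    "\<And>k c. k \<in> S \<Longrightarrow> c \<in> T k \<Longrightarrow> lc_eval Y' c (p k) (q k) = 0"
    by metis
  have "card S \<noteq> 0"
    using S by simp
  then consider "card S = 1" | "card S = 2" "0 \<in> H \<and> 1 \<in> H" | "2 \<le> card S" "\<not> (0 \<in> H \<and> 1 \<in> H)" | "3 \<le> card S"
    by linarith
  then show ?thesis
  proof cases
    case 1
    then obtain k where k: "S = {k}"
      by (rule card_1_singletonE)
    have ak: "Y (Y1 k) \<noteq> 0"
      using k S(2) genericD(2)[OF Y, of "Y1 k"] by simp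
    \<comment> \<open>The global rows act on a vector supported on one vertex as the constraints \<open>x = 0\<close> and \<open>y = 0\<close>.\<close>
    let ?T = "T k \<union> {c. c = CX \<and> 0 \<in> H} \<union> {c. c = CY \<and> 1 \<in> H}"
    have proper: "proper_constraint n c" if "c \<in> ?T" for c
      using that T(1) by auto
    have sol: "lc_eval Y c (x k) (y k) = 0" if "c \<in> ?T" for c
      using that T(2) global ak by (auto simp: k)
    have nz: "x k \<noteq> 0 \<or> y k \<noteq> 0"
      using Snz[of k] k by simp
    have "\<exists>p' q'. (p' \<noteq> 0 \<or> q' \<noteq> 0) \<and> (\<forall>c\<in>?T. lc_eval Y' c p' q' = 0)"
      by (rule common_solution_transfer[OF Y proper nz sol])
    then obtain p' q' where p': "p' \<noteq> 0 \<or> q' \<noteq> 0" "\<And>c. c \<in> ?T \<Longrightarrow> lc_eval Y' c p' q' = 0"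
      by blast
    have "0 \<in> H \<Longrightarrow> p' = 0" "1 \<in> H \<Longrightarrow> q' = 0"
      using p'(2)[of CX] p'(2)[of CY] by auto
    then show ?thesis
      using p' k by (intro build[of "\<lambda>_. p'" "\<lambda>_. q'" "\<lambda>_. 1"]) auto
  next
    case 2
    then obtain k m where km: "S = {k, m}" "k \<noteq> m"
      by (meson card_2_iff)
    have ak: "Y (Y1 k) \<noteq> 0" "Y (Y1 m) \<noteq> 0"
      using km S(2) genericD(2)[OF Y, of "Y1 k"] genericD(2)[OF Y, of "Y1 m"] by simp_all
    have eqs: "Y (Y1 k) * x k + Y (Y1 m) * x m = 0" "Y (Y1 k) * y k + Y (Y1 m) * y m = 0"
      using global 2 km by simp_all
    \<comment> \<open>Both global equations force the vectors at the two vertices to be proportional.\<close>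
    define r where "r = - Y (Y1 k) / Y (Y1 m)"
    have r: "r \<noteq> 0" "x m = r * x k" "y m = r * y k"
      using ak eqs by (simp_all add: r_def field_simps)
    have sol: "lc_eval Y c (x k) (y k) = 0" if "c \<in> T k \<union> T m" for c
    proof (cases "c \<in> T k")
      case True
      then show ?thesis
        by (rule T(2))
    next
      case False
      then have "lc_eval Y c (r * x k) (r * y k) = 0"
        using that T(2)[of c m] r by simp
      then have "r * (x k * lc_eval Y c 1 0 + y k * lc_eval Y c 0 1) = 0"
        by (simp add: lc_eval_linear[of Y c "r * x k"] distrib_left mult.assoc)
      then show ?thesis
        using r(1) by (simp add: lc_eval_linear[of Y c "x k"])
    qed
    have proper: "proper_constraint n c" if "c \<in> T k \<union> T m" for c
      using that T(1) by auto
    have nz: "x k \<noteq> 0 \<or> y k \<noteq> 0"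
      using Snz[of k] km by simp
    have "\<exists>p' q'. (p' \<noteq> 0 \<or> q' \<noteq> 0) \<and> (\<forall>c\<in>T k \<union> T m. lc_eval Y' c p' q' = 0)"
      by (rule common_solution_transfer[OF Y proper nz sol])
    then obtain p' q' where p': "p' \<noteq> 0 \<or> q' \<noteq> 0" "\<And>c. c \<in> T k \<union> T m \<Longrightarrow> lc_eval Y' c p' q' = 0"
      by blast
    obtain t where t: "\<exists>k\<in>S. t k \<noteq> 0" "(\<Sum>k\<in>S. t k * Y' (Y1 k)) = 0"
      using one_equation_nontrivial[of S "\<lambda>k. Y' (Y1 k)"] S 2 by auto
    have "(\<Sum>k\<in>S. t k * (Y' (Y1 k) * u)) = 0" for u
      using t(2) by (simp add: mult.assoc[symmetric] sum_distrib_right[symmetric])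
    then show ?thesis
      using p' km t(1) by (intro build[of "\<lambda>_. p'" "\<lambda>_. q'" t]) auto
  next
    case 3
    let ?f = "\<lambda>k. if 0 \<in> H then Y' (Y1 k) * p k else Y' (Y1 k) * q k"
    obtain t where t: "\<exists>k\<in>S. t k \<noteq> 0" "(\<Sum>k\<in>S. t k * ?f k) = 0"
      using one_equation_nontrivial[of S ?f] S 3 by auto
    show ?thesis
      by (rule build[of p q t]) (use pq t 3 in auto)
  next
    case 4
    obtain t where t: "\<exists>k\<in>S. t k \<noteq> 0" "(\<Sum>k\<in>S. t k * (Y' (Y1 k) * p k)) = 0"
      "(\<Sum>k\<in>S. t k * (Y' (Y1 k) * q k)) = 0"
      using two_equations_nontrivial[of S "\<lambda>k. Y' (Y1 k) * p k" "\<lambda>k. Y' (Y1 k) * q k"] S 4 by auto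
    show ?thesis
      by (rule build[of p q t]) (use pq t in auto)
  qed
qed

text \<open>
  A maximal minor that vanishes at one generic point vanishes identically, so every sign change of a
  maximal minor takes place on a wall.
\<close>

lemma max_minor_zero_transfer:
  assumes "generic n Y" "H \<in> max_row_sets n" "max_minor n Y H = 0"
  shows "max_minor n Y' H = 0"
  using assms kernel_vector_transfer[OF assms(1) max_row_setsD(3)[OF assms(2)]]
  unfolding max_minor_eq_0_iff_kernel_vector[OF assms(2)] by blast

section \<open>Regions and their frontiers\<close>

lemma continuous_map_coordinate: "continuous_map (RM n) euclideanreal (\<lambda>Y. Y v)"
proof (cases "v \<in> vars n")
  case True
  then show ?thesis
    unfolding RM_def by (rule continuous_map_product_coordinates)
next
  case False
  \<comment> \<open>All points of \<open>RM n\<close> take the same value at \<open>v\<close>.\<close>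
  have "continuous_map (RM n) euclideanreal (\<lambda>Y. undefined :: real)"
    by simp
  then show ?thesis
    by (rule continuous_map_eq) (use False in \<open>simp add: topspace_RM extensional_def\<close>)
qed

lemma continuous_map_A_entry: "continuous_map (RM n) euclideanreal (\<lambda>Y. A_entry n Y i j)"
proof -
  have diff: "continuous_map (RM n) euclideanreal (\<lambda>Y. diff2 Y a k l)" for a k l
    by (cases "k < l") (simp_all add: diff2_def continuous_map_coordinate)
  have lc: "continuous_map (RM n) euclideanreal (\<lambda>Y. lc_eval Y c 1 0)"
    "continuous_map (RM n) euclideanreal (\<lambda>Y. lc_eval Y c 0 1)" for c
    by (cases c; simp add: diff lc_eval.simps(3))+
  obtain k c where kc: "row_label n i = (k, c)"
    by fastforce
  consider "i = 0" | "i = 1" | "2 \<le> i"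
    by linarith
  then show ?thesis
  proof cases
    case 1
    then show ?thesis
      unfolding A_entry_def by (cases "j < n") (simp_all add: continuous_map_coordinate)
  next
    case 2
    then show ?thesis
      unfolding A_entry_def by (cases "j < n") (simp_all add: continuous_map_coordinate)
  next
    case 3
    then show ?thesis
      unfolding A_entry_def kc by (cases "j = k - 1"; cases "j = n + k - 1") (simp_all add: lc)
  qed
qed

lemma continuous_map_max_minor:
  assumes "H \<in> max_row_sets n"
  shows "continuous_map (RM n) euclideanreal (\<lambda>Y. max_minor n Y H)"
proof -
  have *: "max_minor n Y H = (\<Sum>p\<in>{p. p permutes {0..<2 * n}}.
      signof p * (\<Prod>i=0..<2 * n. A_entry n Y (pick H i) (p i)))" for Y
    unfolding max_minor_eq[OF assms] by (subst det_def'[of _ "2 * n"]) (auto intro!: sum.cong prod.cong)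
  show ?thesis
    unfolding * by (intro continuous_map_sum continuous_map_real_mult continuous_map_prod
        continuous_map_A_entry) (simp_all add: finite_permutations)
qed

definition region :: "nat \<Rightarrow> (pvar \<Rightarrow> real) \<Rightarrow> (pvar \<Rightarrow> real) set" where
  "region n Y = {Y' \<in> topspace (RM n). \<forall>H\<in>max_row_sets n. sgn (max_minor n Y' H) = sgn (max_minor n Y H)}"

lemma finite_max_row_sets: "finite (max_row_sets n)"
  unfolding max_row_sets_def by (rule finite_subset[of _ "Pow {..<num_rows n}"]) auto

lemma openin_max_minor_sgn:
  assumes "H \<in> max_row_sets n" "max_minor n Y H \<noteq> 0"
  shows "openin (RM n) {Y' \<in> topspace (RM n). sgn (max_minor n Y' H) = sgn (max_minor n Y H)}"
proof (cases "0 < max_minor n Y H")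
  case True
  then have "{Y' \<in> topspace (RM n). sgn (max_minor n Y' H) = sgn (max_minor n Y H)} =
      {Y' \<in> topspace (RM n). max_minor n Y' H \<in> {0<..}}"
    by (auto simp: sgn_if split: if_splits)
  then show ?thesis
    using openin_continuous_map_preimage[OF continuous_map_max_minor[OF assms(1)], of "{0<..}"]
    by simp
next
  case False
  then have "{Y' \<in> topspace (RM n). sgn (max_minor n Y' H) = sgn (max_minor n Y H)} =
      {Y' \<in> topspace (RM n). max_minor n Y' H \<in> {..<0}}"
    using assms(2) by (auto simp: sgn_if split: if_splits)
  then show ?thesis
    using openin_continuous_map_preimage[OF continuous_map_max_minor[OF assms(1)], of "{..<0}"]
    by simp
qed

text \<open>
  A region is cut out by signs. The conditions with sign 0 hold everywhere, and the
  others are open.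
\<close>

lemma openin_region:
  assumes "generic n Y"
  shows "openin (RM n) (region n Y)"
proof -
  let ?G = "{H \<in> max_row_sets n. max_minor n Y H \<noteq> 0}"
  let ?U = "\<lambda>H. {Y' \<in> topspace (RM n). sgn (max_minor n Y' H) = sgn (max_minor n Y H)}"
  have "region n Y = topspace (RM n) \<inter> \<Inter>(?U ` ?G)"
  proof (intro Set.equalityI subsetI)
    fix Y' assume Y': "Y' \<in> topspace (RM n) \<inter> \<Inter>(?U ` ?G)"
    have "sgn (max_minor n Y' H) = sgn (max_minor n Y H)" if H: "H \<in> max_row_sets n" for H
    proof (cases "max_minor n Y H = 0")
      case True
      then show ?thesis
        using max_minor_zero_transfer[OF assms H] by simp
    next
      case False
      then show ?thesis
        using Y' H by blast
    qed
    then show "Y' \<in> region n Y"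
      using Y' by (simp add: region_def)
  qed (auto simp: region_def)
  moreover have "openin (RM n) (topspace (RM n) \<inter> \<Inter>(?U ` ?G))"
  proof (cases "?G = {}")
    case True
    show ?thesis
      by (simp only: True image_empty Inter_empty Int_UNIV_right openin_topspace)
  next
    case False
    then show ?thesis
      using finite_max_row_sets[of n]
      by (intro openin_Int openin_topspace openin_Inter) (auto intro: openin_max_minor_sgn)
  qed
  ultimately show ?thesis
    by simp
qed

lemma mem_region_self: "Y \<in> topspace (RM n) \<Longrightarrow> Y \<in> region n Y"
  by (simp add: region_def)

lemma region_eq: "Y' \<in> region n Y \<Longrightarrow> region n Y' = region n Y"
  by (simp add: region_def)

lemma region_unique:
  assumes "R \<in> regions n" "Y \<in> R"
  shows "R = region n Y"
proof -
  obtain \<sigma> where \<sigma>: "R = {Y \<in> topspace (RM n). \<forall>H \<in> max_row_sets n. sgn (max_minor n Y H) = \<sigma> H}"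
    using assms(1) unfolding regions_def by blast
  then show ?thesis
    using assms(2) by (auto simp: region_def)
qed

lemma region_in_maximal_open_regions:
  assumes "generic n Y"
  shows "region n Y \<in> maximal_open_regions n"
proof -
  have Y: "Y \<in> region n Y"
    using genericD(1)[OF assms] by (rule mem_region_self)
  have "region n Y \<in> regions n"
    unfolding regions_def mem_Collect_eq
  proof
    show "region n Y \<noteq> {}"
      using Y by blast
    show "\<exists>\<sigma>. region n Y = {Y \<in> topspace (RM n). \<forall>H \<in> max_row_sets n. sgn (max_minor n Y H) = \<sigma> H}"
      by (rule exI[of _ "\<lambda>H. sgn (max_minor n Y H)"]) (simp add: region_def)
  qed
  moreover have "R' = region n Y" if "R' \<in> regions n" "region n Y \<subseteq> R'" for R'
    using region_unique[OF that(1)] that(2) Y by blast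
  ultimately show ?thesis
    using openin_region[OF assms] by (simp add: maximal_open_regions_def)
qed

lemma finite_maximal_open_regions: "finite (maximal_open_regions n)"
proof -
  let ?R = "\<lambda>\<sigma>. {Y \<in> topspace (RM n). \<forall>H \<in> max_row_sets n. sgn (max_minor n Y H) = \<sigma> H}"
  have "maximal_open_regions n \<subseteq> ?R ` (\<Pi>\<^sub>E H\<in>max_row_sets n. {- 1, 0, 1})"
  proof
    fix R assume "R \<in> maximal_open_regions n"
    then have R: "R \<in> regions n"
      by (simp add: maximal_open_regions_def)
    then obtain Y where Y: "Y \<in> R"
      by (auto simp: regions_def)
    let ?\<sigma> = "restrict (\<lambda>H. sgn (max_minor n Y H)) (max_row_sets n)"
    have "R = ?R ?\<sigma>"
      using region_unique[OF R Y] by (simp add: region_def)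
    moreover have "?\<sigma> \<in> (\<Pi>\<^sub>E H\<in>max_row_sets n. {- 1, 0, 1})"
      by (auto simp: sgn_if)
    ultimately show "R \<in> ?R ` (\<Pi>\<^sub>E H\<in>max_row_sets n. {- 1, 0, 1})"
      by blast
  qed
  then show ?thesis
    by (rule finite_subset) (simp add: finite_PiE finite_max_row_sets)
qed

text \<open>
  A point off the walls has its whole region as a neighbourhood. If it lies in the closure of \<open>R\<close>, its
  region meets \<open>R\<close>, hence equals \<open>R\<close>, and the point is interior.
\<close>

lemma frontier_subset_walls:
  assumes "R \<in> maximal_open_regions n"
  shows "(RM n) frontier_of (Abstract_Topology.closure_of (RM n) R) \<subseteq> \<Union>(walls n)"
proof
  fix Y assume Y: "Y \<in> (RM n) frontier_of (Abstract_Topology.closure_of (RM n) R)"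
  then have cl: "Y \<in> Abstract_Topology.closure_of (RM n) R"
    and int: "Y \<notin> (RM n) interior_of (Abstract_Topology.closure_of (RM n) R)"
    by (simp_all add: frontier_of_def)
  show "Y \<in> \<Union>(walls n)"
  proof (rule ccontr)
    assume "Y \<notin> \<Union>(walls n)"
    then have gen: "generic n Y"
      using cl by (simp add: generic_def in_closure_of)
    then have YR: "Y \<in> region n Y" and op: "openin (RM n) (region n Y)"
      using openin_region mem_region_self genericD(1) by blast+
    then obtain Y' where "Y' \<in> R" "Y' \<in> region n Y"
      using cl unfolding in_closure_of by blast
    moreover have R: "R \<in> regions n" and Rtop: "R \<subseteq> topspace (RM n)"
      using assms by (auto simp: maximal_open_regions_def regions_def)
    ultimately have "region n Y = R"
      using region_unique[OF R] region_eq by metis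
    then have "region n Y \<subseteq> (RM n) interior_of (Abstract_Topology.closure_of (RM n) R)"
      using op Rtop by (intro interior_of_maximal) (simp_all add: closure_of_subset)
    then show False
      using YR int by blast
  qed
qed

lemma sgn_constant_on_interval:
  fixes h :: "real \<Rightarrow> real"
  assumes "continuous_on {a<..<b} h" "\<And>t. t \<in> {a<..<b} \<Longrightarrow> h t \<noteq> 0" and st: "s \<in> {a<..<b}" "t \<in> {a<..<b}"
  shows "sgn (h s) = sgn (h t)"
proof (rule ccontr)
  assume neq: "sgn (h s) \<noteq> sgn (h t)"
  have conn: "connected (h ` {a<..<b})"
    by (rule connected_continuous_image[OF assms(1)]) simp
  have "0 \<in> h ` {a<..<b}"
  proof (cases "h s < 0")
    case True
    then have "0 < h t"
      using neq assms(2)[OF st(2)] by (auto simp: sgn_if split: if_splits)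
    then show ?thesis
      using connectedD_interval[OF conn, of "h s" "h t" 0] st True by simp
  next
    case False
    then have "h t < 0" "0 < h s"
      using neq assms(2)[OF st(1)] assms(2)[OF st(2)] by (auto simp: sgn_if split: if_splits)
    then show ?thesis
      using connectedD_interval[OF conn, of "h t" "h s" 0] st by simp
  qed
  then show False
    using assms(2) by force
qed

lemma topspace_RM_upd: "Y \<in> topspace (RM n) \<Longrightarrow> v \<in> vars n \<Longrightarrow> Y(v := t) \<in> topspace (RM n)"
  by (auto simp: topspace_RM extensional_def)

lemma continuous_map_line:
  assumes "Y \<in> topspace (RM n)" "v \<in> vars n"
  shows "continuous_map euclideanreal (RM n) (\<lambda>t. Y(v := t))"
proof -
  have "continuous_map euclideanreal euclideanreal (\<lambda>t. (Y(v := t)) w)" for w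
    by (cases "w = v") auto
  moreover have "Y(v := t) \<in> extensional (vars n)" for t
    using topspace_RM_upd[OF assms] by (simp add: topspace_RM)
  ultimately show ?thesis
    unfolding RM_def by (subst continuous_map_componentwise) auto
qed

text \<open>
  Move the coordinate \<open>v\<close> through its value at \<open>Y\<close>. On one side, the points near \<open>Y\<close> are generic, so every
  maximal minor keeps its sign there and they all lie in one region. The minor of \<open>H\<close> is affine along the
  line and has a simple zero at \<open>Y\<close>, so on the other side it has the opposite sign, which keeps
  a neighbourhood of these points away from that region.
\<close>

lemma sign_change_in_frontier:
  assumes Y: "Y \<in> topspace (RM n)" and v: "v \<in> vars n" and H: "H \<in> max_row_sets n"
    and aff: "affine_fun (\<lambda>t. max_minor n (Y(v := t)) H)" and zero: "max_minor n Y H = 0"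
    and ev: "eventually (\<lambda>t. generic n (Y(v := t)) \<and> max_minor n (Y(v := t)) H \<noteq> 0) (at (Y v))"
  shows "\<exists>R\<in>maximal_open_regions n. Y \<in> (RM n) frontier_of (Abstract_Topology.closure_of (RM n) R)"
proof -
  define t0 where "t0 = Y v"
  define \<gamma> where "\<gamma> t = Y(v := t)" for t
  have \<gamma>0: "\<gamma> t0 = Y"
    by (simp add: \<gamma>_def t0_def)
  have \<gamma>top: "\<gamma> t \<in> topspace (RM n)" for t
    using topspace_RM_upd[OF Y v] by (simp add: \<gamma>_def)
  have pre: "open {t. \<gamma> t \<in> U}" if "openin (RM n) U" for U
    using openin_continuous_map_preimage[OF continuous_map_line[OF Y v] that] by (simp add: \<gamma>_def)
  obtain \<epsilon> where \<epsilon>: "\<epsilon> > 0" "\<And>t. t \<noteq> t0 \<Longrightarrow> dist t t0 < \<epsilon> \<Longrightarrow> generic n (\<gamma> t) \<and> max_minor n (\<gamma> t) H \<noteq> 0"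
    using ev unfolding eventually_at \<gamma>_def t0_def by auto
  have cont: "continuous_on UNIV (\<lambda>t. max_minor n (\<gamma> t) K)" if "K \<in> max_row_sets n" for K
    using continuous_map_compose[OF continuous_map_line[OF Y v] continuous_map_max_minor[OF that]]
    by (simp add: comp_def \<gamma>_def)
  define s where "s = t0 + \<epsilon> / 2"
  have s: "s \<in> {t0<..<t0 + \<epsilon>}"
    using \<epsilon>(1) by (simp add: s_def)
  have gen: "generic n (\<gamma> t)" "max_minor n (\<gamma> t) H \<noteq> 0" if "t \<noteq> t0" "\<bar>t - t0\<bar> < \<epsilon>" for t
    using \<epsilon>(2)[of t] that by (simp_all add: dist_real_def)
  let ?R = "region n (\<gamma> s)"
  have R: "?R \<in> maximal_open_regions n"
    using s by (intro region_in_maximal_open_regions gen) auto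
  have right: "\<gamma> t \<in> ?R" if t: "t \<in> {t0<..<t0 + \<epsilon>}" for t
  proof -
    have "sgn (max_minor n (\<gamma> t) K) = sgn (max_minor n (\<gamma> s) K)" if K: "K \<in> max_row_sets n" for K
    proof (cases "\<exists>r\<in>{t0<..<t0 + \<epsilon>}. max_minor n (\<gamma> r) K = 0")
      case True
      then obtain r where "r \<in> {t0<..<t0 + \<epsilon>}" "max_minor n (\<gamma> r) K = 0"
        by blast
      moreover from this have "generic n (\<gamma> r)"
        by (intro gen) auto
      ultimately show ?thesis
        using max_minor_zero_transfer[OF _ K] by simp
    next
      case False
      then show ?thesis
        using sgn_constant_on_interval[OF continuous_on_subset[OF cont[OF K]] _ t s] by simp
    qed
    then show ?thesis
      using \<gamma>top by (simp add: region_def)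
  qed
  have "Y \<in> Abstract_Topology.closure_of (RM n) ?R"
    unfolding in_closure_of
  proof (intro conjI allI impI)
    fix U assume U: "Y \<in> U \<and> openin (RM n) U"
    then have "open {t. \<gamma> t \<in> U}" "t0 \<in> {t. \<gamma> t \<in> U}"
      using pre \<gamma>0 by simp_all
    then obtain d where d: "d > 0" "\<And>t. dist t t0 < d \<Longrightarrow> \<gamma> t \<in> U"
      unfolding open_dist by blast
    let ?t = "t0 + min d \<epsilon> / 2"
    have "\<gamma> ?t \<in> U"
      using d \<epsilon>(1) by (intro d(2)) (simp add: dist_real_def)
    moreover have "\<gamma> ?t \<in> ?R"
      using d(1) \<epsilon>(1) by (intro right) auto
    ultimately show "\<exists>y. y \<in> ?R \<and> y \<in> U"
      by blast
  qed (rule Y)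
  moreover have "Y \<notin> (RM n) interior_of (Abstract_Topology.closure_of (RM n) ?R)"
  proof
    let ?I = "(RM n) interior_of (Abstract_Topology.closure_of (RM n) ?R)"
    assume "Y \<in> ?I"
    then have "open {t. \<gamma> t \<in> ?I}" "t0 \<in> {t. \<gamma> t \<in> ?I}"
      using pre[of ?I] \<gamma>0 by simp_all
    then obtain d where d: "d > 0" "\<And>t. dist t t0 < d \<Longrightarrow> \<gamma> t \<in> ?I"
      unfolding open_dist by blast
    define t where "t = t0 - min d \<epsilon> / 2"
    have t: "\<bar>t - t0\<bar> < \<epsilon>" "t < t0" "dist t t0 < d"
      using d(1) \<epsilon>(1) by (simp_all add: t_def dist_real_def)
    then have nz: "max_minor n (\<gamma> t) H \<noteq> 0"
      by (intro gen) auto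
    let ?U = "{Y' \<in> topspace (RM n). sgn (max_minor n Y' H) = sgn (max_minor n (\<gamma> t) H)}"
    have "\<gamma> t \<in> Abstract_Topology.closure_of (RM n) ?R"
      using d(2)[OF t(3)] by (rule subsetD[OF interior_of_subset])
    then have "\<gamma> t \<in> ?U \<and> openin (RM n) ?U \<longrightarrow> (\<exists>y. y \<in> ?R \<and> y \<in> ?U)"
      unfolding in_closure_of by (elim conjE allE)
    moreover have "openin (RM n) ?U"
      by (rule openin_max_minor_sgn[OF H nz])
    ultimately obtain Y' where "Y' \<in> ?R" "sgn (max_minor n Y' H) = sgn (max_minor n (\<gamma> t) H)"
      using \<gamma>top[of t] by auto
    then have sgn_eq: "sgn (max_minor n (\<gamma> s) H) = sgn (max_minor n (\<gamma> t) H)"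
      using H by (simp add: region_def)
    obtain \<alpha> \<beta> where ab: "\<And>r. max_minor n (\<gamma> r) H = \<alpha> + \<beta> * r"
      using aff unfolding affine_fun_def \<gamma>_def by (elim exE) simp
    have "\<alpha> = - \<beta> * t0"
      using ab[of t0] zero \<gamma>0 by simp
    then have lin: "max_minor n (\<gamma> r) H = \<beta> * (r - t0)" for r
      by (simp add: ab algebra_simps)
    have "sgn \<beta> = - sgn \<beta>"
      using sgn_eq s t(2) by (simp add: lin sgn_mult)
    then have "\<beta> = 0"
      by (simp add: sgn_if split: if_splits)
    then show False
      using nz lin by simp
  qed
  ultimately have "Y \<in> (RM n) frontier_of (Abstract_Topology.closure_of (RM n) ?R)"
    by (simp add: frontier_of_def)
  then show ?thesis
    using R by blast
qed

section \<open>Every wall is crossed\<close>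

text \<open>
  Some rows \<open>E\<close> of the upper block, completed by the unit rows outside the columns \<open>C\<close>. Up to sign its maximal
  minor is the minor with rows \<open>E\<close> and columns \<open>C\<close>.
\<close>

definition row_set :: "nat \<Rightarrow> nat set \<Rightarrow> nat set \<Rightarrow> nat set" where
  "row_set n E C = E \<union> (\<lambda>c. 2 + n * (n - 1) + c) ` ({..<2 * n} - C)"

lemma row_set_max_row_sets:
  assumes "E \<subseteq> {..<2 + n * (n - 1)}" "C \<subseteq> {..<2 * n}" "card E = card C"
  shows "row_set n E C \<in> max_row_sets n"
proof -
  have fin: "finite E" "finite C"
    using assms(1,2) finite_subset by blast+
  have "E \<inter> (\<lambda>c. 2 + n * (n - 1) + c) ` ({..<2 * n} - C) = {}"
    using assms(1) by fastforce
  then have "card (row_set n E C) = card E + card ((\<lambda>c. 2 + n * (n - 1) + c) ` ({..<2 * n} - C))"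
    unfolding row_set_def by (intro card_Un_disjoint) (use fin in auto)
  also have "card ((\<lambda>c. 2 + n * (n - 1) + c) ` ({..<2 * n} - C)) = 2 * n - card C"
    using assms(2) fin by (subst card_image) (auto simp: card_Diff_subset)
  also have "card E + (2 * n - card C) = 2 * n"
    using assms(3) card_mono[OF _ assms(2)] by simp
  finally show ?thesis
    using assms(1) by (auto simp: max_row_sets_def row_set_def num_rows_def)
qed

lemma row_label_unit_not_CE: "row_label n (2 + n * (n - 1) + c) \<noteq> (k, CE l m)"
  unfolding row_label_unit by auto

lemma ex_player2_row:
  assumes "k \<in> {1..n}" "l \<in> {1..n}" "k \<noteq> l"
  shows "\<exists>i. 2 \<le> i \<and> i < 2 + n * (n - 1) \<and> row_label n i = (k, CE k l)"
proof -
  have "(k, l) \<in> set (ordered_pairs n)"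
    using assms by (simp add: set_ordered_pairs)
  then obtain i where "i < n * (n - 1)" "ordered_pairs n ! i = (k, l)"
    unfolding in_set_conv_nth length_ordered_pairs by blast
  then show ?thesis
    by (intro exI[of _ "2 + i"]) (simp add: row_label_def)
qed

lemma kernel_vector_row_set:
  assumes "E \<subseteq> {..<2 + n * (n - 1)}"
  shows "kernel_vector n Y (row_set n E C) x y \<longleftrightarrow>
     (\<exists>k\<in>{1..n}. x k \<noteq> 0 \<or> y k \<noteq> 0) \<and>
     (0 \<in> E \<longrightarrow> (\<Sum>k=1..n. Y (Y1 k) * x k) = 0) \<and>
     (1 \<in> E \<longrightarrow> (\<Sum>k=1..n. Y (Y1 k) * y k) = 0) \<and>
     (\<forall>i\<in>E. 2 \<le> i \<longrightarrow> (case row_label n i of (k, c) \<Rightarrow> lc_eval Y c (x k) (y k) = 0)) \<and>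
     (\<forall>k\<in>{1..n}. (k - 1 \<notin> C \<longrightarrow> x k = 0) \<and> (n + k - 1 \<notin> C \<longrightarrow> y k = 0))"
proof -
  let ?N = "2 + n * (n - 1)"
  let ?ok = "\<lambda>i. case row_label n i of (k, c) \<Rightarrow> lc_eval Y c (x k) (y k) = 0"
  have mem: "0 \<in> row_set n E C \<longleftrightarrow> 0 \<in> E" "1 \<in> row_set n E C \<longleftrightarrow> 1 \<in> E"
    by (auto simp: row_set_def)
  have "(\<forall>i\<in>row_set n E C. 2 \<le> i \<longrightarrow> ?ok i) \<longleftrightarrow>
      (\<forall>i\<in>E. 2 \<le> i \<longrightarrow> ?ok i) \<and> (\<forall>c\<in>{..<2 * n} - C. ?ok (?N + c))"
    unfolding row_set_def by (auto simp: ball_Un)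
  also have "(\<forall>c\<in>{..<2 * n} - C. ?ok (?N + c)) \<longleftrightarrow>
      (\<forall>k\<in>{1..n}. (k - 1 \<notin> C \<longrightarrow> x k = 0) \<and> (n + k - 1 \<notin> C \<longrightarrow> y k = 0))" (is "?L \<longleftrightarrow> ?R")
  proof
    assume L: ?L
    show ?R
    proof (intro ballI conjI impI)
      fix k assume k: "k \<in> {1..n}"
      then obtain j where j: "k = Suc j" "j < n"
        by (cases k) auto
      show "x k = 0" if "k - 1 \<notin> C"
      proof -
        have "j \<in> {..<2 * n} - C"
          using that j by simp
        from L[rule_format, OF this] show ?thesis
          using j unfolding row_label_unit by simp
      qed
      show "y k = 0" if "n + k - 1 \<notin> C"
      proof -
        have "n + j \<in> {..<2 * n} - C"
          using that j by simp
        from L[rule_format, OF this] show ?thesis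
          using j unfolding row_label_unit by simp
      qed
    qed
  next
    assume R: ?R
    show ?L
    proof
      fix c assume c: "c \<in> {..<2 * n} - C"
      show "?ok (?N + c)"
      proof (cases "c < n")
        case True
        then show ?thesis
          using R[rule_format, of "c + 1"] c unfolding row_label_unit by simp
      next
        case False
        then have "c - n + 1 \<in> {1..n}" "n + (c - n + 1) - 1 = c"
          using c by auto
        then show ?thesis
          using R[rule_format, of "c - n + 1"] c False unfolding row_label_unit by simp
      qed
    qed
  qed
  finally show ?thesis
    unfolding kernel_vector_def mem by (simp only: conj_assoc)
qed

lemma A_entry_upd_Y1: "2 \<le> i \<Longrightarrow> A_entry n (Y(Y1 k := t)) i j = A_entry n Y i j"
proof -
  assume i: "2 \<le> i"
  obtain m c where mc: "row_label n i = (m, c)"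
    by fastforce
  have "lc_eval (Y(Y1 k := t)) c x y = lc_eval Y c x y" for x y
    by (cases c) (simp_all add: lc_eval_CE)
  then show ?thesis
    using i by (simp add: A_entry_def mc)
qed

lemma A_entry_upd_pair:
  assumes v: "v = bvar P \<or> v = cvar P" and i: "\<And>k l m. row_label n i = (k, CE l m) \<Longrightarrow> i < 2 \<or> sorted_pair l m \<noteq> P"
  shows "A_entry n (Y(v := t)) i j = A_entry n Y i j"
proof (cases "i < 2")
  case True
  then have "i = 0 \<or> i = 1"
    by linarith
  then show ?thesis
    using v by (auto simp: A_entry_def)
next
  case False
  obtain m c where mc: "row_label n i = (m, c)"
    by fastforce
  have "lc_eval (Y(v := t)) c x y = lc_eval Y c x y" for x y
    using i[of m] v False mc by (cases c) (auto simp: lc_eval_CE)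
  then show ?thesis
    using False by (simp add: A_entry_def mc)
qed

text \<open>
  The two variables of a pair \<open>P\<close> only occur in the rows of its two orientations; the hypothesis
  on \<open>E\<close> leaves only one of them.
\<close>

lemma affine_fun_row_set_pair:
  assumes H: "row_set n E C \<in> max_row_sets n" and r: "r \<in> E" and v: "v = bvar P \<or> v = cvar P"
    and E: "\<And>i k l m. i \<in> E \<Longrightarrow> i \<noteq> r \<Longrightarrow> row_label n i = (k, CE l m) \<Longrightarrow> i < 2 \<or> sorted_pair l m \<noteq> P"
  shows "affine_fun (\<lambda>t. max_minor n (Y(v := t)) (row_set n E C))"
proof (rule affine_fun_max_minor[OF H])
  show "r \<in> row_set n E C"
    using r by (simp add: row_set_def)
  fix i j t assume i: "i \<in> row_set n E C" "i \<noteq> r"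
  show "A_entry n (Y(v := t)) i j = A_entry n Y i j"
  proof (rule A_entry_upd_pair[OF v])
    fix k l m assume label: "row_label n i = (k, CE l m)"
    then have "i \<in> E"
      using i(1) row_label_unit_not_CE unfolding row_set_def by blast
    then show "i < 2 \<or> sorted_pair l m \<noteq> P"
      using E i(2) label by blast
  qed
qed

lemma hyperplane_minor_Y1:
  assumes k: "k \<in> {1..n}"
  shows "\<exists>H\<in>max_row_sets n. (\<forall>Y. affine_fun (\<lambda>t. max_minor n (Y(Y1 k := t)) H)) \<and>
    (\<forall>Y. max_minor n Y H = 0 \<longleftrightarrow> Y (Y1 k) = 0)"
proof -
  let ?H = "row_set n {0} {k - 1}"
  have E: "{0} \<subseteq> {..<2 + n * (n - 1)}"
    by simp
  have H: "?H \<in> max_row_sets n"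
    using k by (intro row_set_max_row_sets) auto
  have "affine_fun (\<lambda>t. max_minor n (Y(Y1 k := t)) ?H)" for Y
    by (rule affine_fun_max_minor[OF H, of 0]) (auto simp: row_set_def A_entry_upd_Y1)
  moreover have "max_minor n Y ?H = 0 \<longleftrightarrow> Y (Y1 k) = 0" for Y
  proof -
    have sum: "(\<Sum>j=1..n. Y (Y1 j) * x j) = Y (Y1 k) * x k" if "\<And>j. j \<in> {1..n} \<Longrightarrow> j \<noteq> k \<Longrightarrow> x j = 0" for x
      using that k by (subst sum.remove[of _ k]) auto
    have "max_minor n Y ?H = 0 \<longleftrightarrow> (\<exists>x y. kernel_vector n Y ?H x y)"
      by (rule max_minor_eq_0_iff_kernel_vector[OF H])
    also have "\<dots> \<longleftrightarrow> Y (Y1 k) = 0"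
    proof
      assume "\<exists>x y. kernel_vector n Y ?H x y"
      then obtain x y where *: "kernel_vector n Y ?H x y"
        by blast
      have x: "x j = 0" if "j \<in> {1..n}" "j \<noteq> k" for j
        using * that k unfolding kernel_vector_row_set[OF E] by auto
      have y: "y j = 0" if "j \<in> {1..n}" for j
        using * that k unfolding kernel_vector_row_set[OF E] by auto
      have "x k \<noteq> 0"
        using * x y unfolding kernel_vector_row_set[OF E] by metis
      moreover have "Y (Y1 k) * x k = 0"
        using * sum[OF x] unfolding kernel_vector_row_set[OF E] by simp
      ultimately show "Y (Y1 k) = 0"
        by simp
    next
      assume Yk: "Y (Y1 k) = 0"
      have "kernel_vector n Y ?H (\<lambda>j. if j = k then 1 else 0) (\<lambda>_. 0)"
        unfolding kernel_vector_row_set[OF E] using k Yk sum[of "\<lambda>j. if j = k then 1 else 0"] by auto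
      then show "\<exists>x y. kernel_vector n Y ?H x y"
        by blast
    qed
    finally show ?thesis .
  qed
  ultimately show ?thesis
    using H by blast
qed

text \<open>
  With one row of player 2, and unit rows that leave one column uncovered, the minor is an entry of
  \<open>A(Y)\<close> up to sign.
\<close>

lemma hyperplane_minor_pair:
  assumes P: "P \<in> pairs n" and v: "v = bvar P \<or> v = cvar P"
  shows "\<exists>H\<in>max_row_sets n. (\<forall>Y. affine_fun (\<lambda>t. max_minor n (Y(v := t)) H)) \<and>
    (\<forall>Y. max_minor n Y H = 0 \<longleftrightarrow> Y v = 0)"
proof -
  obtain k l where kl: "P = (k, l)" "k \<in> {1..n}" "l \<in> {1..n}" "k < l"
    using P by (auto simp: pairs_def)
  then obtain i where i: "2 \<le> i" "i < 2 + n * (n - 1)" "row_label n i = (k, CE k l)"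
    using ex_player2_row[of k n l] by auto
  have P_eq: "sorted_pair k l = P"
    using kl by (simp add: sorted_pair_def)
  define c where "c = (if v = bvar P then k - 1 else n + k - 1)"
  let ?H = "row_set n {i} {c}"
  have E: "{i} \<subseteq> {..<2 + n * (n - 1)}"
    using i by simp
  have H: "?H \<in> max_row_sets n"
    using kl by (intro row_set_max_row_sets[OF E]) (auto simp: c_def)
  have "affine_fun (\<lambda>t. max_minor n (Y(v := t)) ?H)" for Y
    by (rule affine_fun_row_set_pair[OF H _ v]) auto
  moreover have "max_minor n Y ?H = 0 \<longleftrightarrow> Y v = 0" for Y
  proof -
    have "max_minor n Y ?H = 0 \<longleftrightarrow> (\<exists>x y. kernel_vector n Y ?H x y)"
      by (rule max_minor_eq_0_iff_kernel_vector[OF H])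
    also have "\<dots> \<longleftrightarrow> Y v = 0"
    proof
      assume "\<exists>x y. kernel_vector n Y ?H x y"
      then obtain x y where *: "kernel_vector n Y ?H x y"
        by blast
      note ker = *[unfolded kernel_vector_row_set[OF E]]
      have eq: "Y (bvar P) * x k + Y (cvar P) * y k = 0"
        using ker i by (simp add: lc_eval_CE_eq_0_iff P_eq)
      have supp: "j - 1 \<noteq> c \<Longrightarrow> x j = 0" "n + j - 1 \<noteq> c \<Longrightarrow> y j = 0" if "j \<in> {1..n}" for j
        using ker that by simp_all
      show "Y v = 0"
      proof (cases "v = bvar P")
        case True
        have x: "x j = 0" if "j \<in> {1..n}" "j \<noteq> k" for j
          by (rule supp(1)[OF that(1)]) (use that kl True in \<open>simp add: c_def; arith\<close>)
        have y: "y j = 0" if "j \<in> {1..n}" for j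
          by (rule supp(2)[OF that(1)]) (use that kl True in \<open>simp add: c_def; arith\<close>)
        have "x k \<noteq> 0"
          using ker x y by metis
        then show ?thesis
          using eq True y[of k] kl by simp
      next
        case False
        have x: "x j = 0" if "j \<in> {1..n}" for j
          by (rule supp(1)[OF that(1)]) (use that kl False in \<open>simp add: c_def; arith\<close>)
        have y: "y j = 0" if "j \<in> {1..n}" "j \<noteq> k" for j
          by (rule supp(2)[OF that(1)]) (use that kl False in \<open>simp add: c_def; arith\<close>)
        have "y k \<noteq> 0"
          using ker x y by metis
        then show ?thesis
          using eq v False x[of k] kl by simp
      qed
    next
      assume Yv: "Y v = 0"
      have "kernel_vector n Y ?H (\<lambda>j. if j = k \<and> v = bvar P then 1 else 0) (\<lambda>j. if j = k \<and> v = cvar P then 1 else 0)"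
        unfolding kernel_vector_row_set[OF E] using kl Yv v i by (auto simp: lc_eval_CE_eq_0_iff P_eq c_def)
      then show "\<exists>x y. kernel_vector n Y ?H x y"
        by blast
    qed
    finally show ?thesis .
  qed
  ultimately show ?thesis
    using H by blast
qed

lemma hyperplane_minor:
  assumes "v \<in> vars n"
  shows "\<exists>H\<in>max_row_sets n. (\<forall>Y. affine_fun (\<lambda>t. max_minor n (Y(v := t)) H)) \<and>
    (\<forall>Y. max_minor n Y H = 0 \<longleftrightarrow> Y v = 0)"
proof -
  consider k where "v = Y1 k" "k \<in> {1..n}" | P where "P \<in> pairs n" "v = bvar P \<or> v = cvar P"
    using assms unfolding vars_eq by blast
  then show ?thesis
    by cases (simp_all only: hyperplane_minor_Y1 hyperplane_minor_pair)
qed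

text \<open>
  For rows of player 2 at the same strategy, the slope binomial would be a \<open>2 \<times> 2\<close> minor. Orienting the
  pairs so that their first entries differ treats all pairs by \<open>4 \<times> 4\<close> minors.
\<close>

lemma distinct_pairs_rows:
  assumes "P \<in> pairs n" "Q \<in> pairs n" "P \<noteq> Q"
  shows "\<exists>k l m l'. k \<noteq> m \<and> k \<noteq> l \<and> m \<noteq> l' \<and> {k, l, m, l'} \<subseteq> {1..n} \<and> sorted_pair k l = P \<and> sorted_pair m l' = Q"
proof -
  obtain a b c d where PQ: "P = (a, b)" "Q = (c, d)"
    by fastforce
  have bounds: "a < b" "c < d" "{a, b, c, d} \<subseteq> {1..n}"
    using assms(1,2) by (auto simp: PQ pairs_def)
  show ?thesis
  proof (cases "a = c")
    case True
    then have "b \<noteq> d \<and> b \<noteq> a \<and> d \<noteq> c \<and> {b, a, d, c} \<subseteq> {1..n} \<and> sorted_pair b a = P \<and> sorted_pair d c = Q"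
      using assms(3) bounds by (auto simp: PQ sorted_pair_def)
    then show ?thesis
      by blast
  next
    case False
    then have "a \<noteq> c \<and> a \<noteq> b \<and> c \<noteq> d \<and> {a, b, c, d} \<subseteq> {1..n} \<and> sorted_pair a b = P \<and> sorted_pair c d = Q"
      using bounds by (auto simp: PQ sorted_pair_def)
    then show ?thesis
      by blast
  qed
qed

text \<open>
  The rows of player 1 and the rows \<open>CE k l\<close>, \<open>CE m l'\<close> are used, with the four columns of \<open>k\<close> and \<open>m\<close>. The rows
  of player 1 make the parts of a kernel vector at \<open>k\<close> and \<open>m\<close> proportional, so a kernel vector
  exists precisely if the two rows of player 2 describe the same line in the plane.
\<close>

lemma quadric_minor:
  assumes P: "P \<in> pairs n" and Q: "Q \<in> pairs n" and "P \<noteq> Q"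
  shows "\<exists>H\<in>max_row_sets n. (\<forall>Y. affine_fun (\<lambda>t. max_minor n (Y(bvar P := t)) H)) \<and>
    (\<forall>Y. (\<forall>v\<in>vars n. Y v \<noteq> 0) \<longrightarrow>
      (max_minor n Y H = 0 \<longleftrightarrow> Y (bvar P) * Y (cvar Q) = Y (cvar P) * Y (bvar Q)))"
proof -
  obtain k l m l' where kl: "k \<noteq> m" "k \<noteq> l" "m \<noteq> l'" "{k, l, m, l'} \<subseteq> {1..n}"
    and PQ: "sorted_pair k l = P" "sorted_pair m l' = Q"
    using distinct_pairs_rows[OF assms] by blast
  then have km: "k \<in> {1..n}" "l \<in> {1..n}" "m \<in> {1..n}" "l' \<in> {1..n}"
    by simp_all
  obtain i where i: "2 \<le> i" "i < 2 + n * (n - 1)" "row_label n i = (k, CE k l)"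
    using ex_player2_row[OF km(1,2) kl(2)] by blast
  obtain i' where i': "2 \<le> i'" "i' < 2 + n * (n - 1)" "row_label n i' = (m, CE m l')"
    using ex_player2_row[OF km(3,4) kl(3)] by blast
  have neq: "i \<noteq> i'"
    using i i' kl(1) by auto
  let ?E = "{0, 1, i, i'}" and ?C = "{k - 1, m - 1, n + k - 1, n + m - 1}"
  let ?H = "row_set n ?E ?C"
  have E: "?E \<subseteq> {..<2 + n * (n - 1)}"
    using i i' by auto
  have "card ?E = 4"
    using i i' neq by simp
  moreover have "distinct [k - 1, m - 1, n + k - 1, n + m - 1]"
    using km kl(1) by auto
  then have "card ?C = 4"
    using distinct_card by fastforce
  moreover have "?C \<subseteq> {..<2 * n}"
    using km by auto
  ultimately have H: "?H \<in> max_row_sets n"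
    using E by (intro row_set_max_row_sets) simp_all
  have "affine_fun (\<lambda>t. max_minor n (Y(bvar P := t)) ?H)" for Y
    by (rule affine_fun_row_set_pair[OF H, of i]) (use i' PQ assms(3) in auto)
  moreover have "max_minor n Y ?H = 0 \<longleftrightarrow> Y (bvar P) * Y (cvar Q) = Y (cvar P) * Y (bvar Q)"
    if Y: "\<forall>v\<in>vars n. Y v \<noteq> 0" for Y
  proof -
    let ?a = "Y (Y1 k)" and ?a' = "Y (Y1 m)"
    have nz: "?a \<noteq> 0" "?a' \<noteq> 0" "Y (cvar P) \<noteq> 0"
      using Y km P by simp_all
    have sum: "(\<Sum>j=1..n. Y (Y1 j) * x j) = ?a * x k + ?a' * x m"
      if x: "\<And>j. j \<in> {1..n} \<Longrightarrow> j \<noteq> k \<Longrightarrow> j \<noteq> m \<Longrightarrow> x j = 0" for x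
    proof -
      have "(\<Sum>j=1..n. Y (Y1 j) * x j) = (\<Sum>j\<in>{k, m}. Y (Y1 j) * x j)"
        by (rule sum.mono_neutral_right) (use km x in auto)
      then show ?thesis
        using kl(1) by simp
    qed
    have "max_minor n Y ?H = 0 \<longleftrightarrow> (\<exists>x y. kernel_vector n Y ?H x y)"
      by (rule max_minor_eq_0_iff_kernel_vector[OF H])
    also have "\<dots> \<longleftrightarrow> Y (bvar P) * Y (cvar Q) = Y (cvar P) * Y (bvar Q)"
    proof
      assume "\<exists>x y. kernel_vector n Y ?H x y"
      then obtain x y where *: "kernel_vector n Y ?H x y"
        by blast
      note ker = *[unfolded kernel_vector_row_set[OF E]]
      have off: "x j = 0" "y j = 0" if "j \<in> {1..n}" "j \<noteq> k" "j \<noteq> m" for j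
      proof -
        have "j - 1 \<notin> ?C" "n + j - 1 \<notin> ?C"
          using that km by auto
        then show "x j = 0" "y j = 0"
          using ker that(1) by blast+
      qed
      have glob: "?a * x k + ?a' * x m = 0" "?a * y k + ?a' * y m = 0"
        using sum[of x, OF off(1)] sum[of y, OF off(2)] ker by simp_all
      have row: "case row_label n r of (k, c) \<Rightarrow> lc_eval Y c (x k) (y k) = 0" if "r \<in> ?E" "2 \<le> r" for r
        by (rule ker[THEN conjunct2, THEN conjunct2, THEN conjunct2, THEN conjunct1, THEN bspec, THEN mp, OF that])
      have loc: "Y (bvar P) * x k + Y (cvar P) * y k = 0" "Y (bvar Q) * x m + Y (cvar Q) * y m = 0"
        using row[of i] row[of i'] i i' PQ by (simp_all add: lc_eval_CE_eq_0_iff)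
      have xm: "?a' * x m = - (?a * x k)" "?a' * y m = - (?a * y k)"
        using glob by linarith+
      have "?a' * (Y (bvar Q) * x m + Y (cvar Q) * y m) = Y (bvar Q) * (?a' * x m) + Y (cvar Q) * (?a' * y m)"
        by (simp add: algebra_simps)
      also have "\<dots> = - ?a * (Y (bvar Q) * x k + Y (cvar Q) * y k)"
        unfolding xm by (simp add: algebra_simps)
      finally have loc': "Y (bvar Q) * x k + Y (cvar Q) * y k = 0"
        using loc(2) nz by simp
      have xk: "x k \<noteq> 0"
      proof
        assume x0: "x k = 0"
        then have "y k = 0"
          using loc(1) nz by simp
        then have "x j = 0 \<and> y j = 0" if "j \<in> {1..n}" for j
          using x0 off[of j] that xm nz by (cases "j = k"; cases "j = m") auto
        then show False
          using ker by blast
      qed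
      \<comment> \<open>Both lines contain the nonzero point \<open>(x k, y k)\<close>.\<close>
      have "(Y (bvar P) * Y (cvar Q) - Y (cvar P) * Y (bvar Q)) * x k =
          (Y (bvar P) * x k + Y (cvar P) * y k) * Y (cvar Q) - (Y (bvar Q) * x k + Y (cvar Q) * y k) * Y (cvar P)"
        by (simp add: algebra_simps)
      then show "Y (bvar P) * Y (cvar Q) = Y (cvar P) * Y (bvar Q)"
        using loc(1) loc' xk by simp
    next
      assume q: "Y (bvar P) * Y (cvar Q) = Y (cvar P) * Y (bvar Q)"
      \<comment> \<open>Direction vectors \<open>(cvar P, - bvar P)\<close> of the common line, scaled to cancel in both rows of player 1.\<close>
      define x where "x j = (if j = k then ?a' * Y (cvar P) else if j = m then - (?a * Y (cvar P)) else 0)" for j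
      define y where "y j = (if j = k then - (?a' * Y (bvar P)) else if j = m then ?a * Y (bvar P) else 0)" for j
      have xy: "x k = ?a' * Y (cvar P)" "x m = - (?a * Y (cvar P))" "y k = - (?a' * Y (bvar P))" "y m = ?a * Y (bvar P)"
        using kl(1) by (simp_all add: x_def y_def)
      have off: "x j = 0" "y j = 0" if "j \<noteq> k" "j \<noteq> m" for j
        using that by (simp_all add: x_def y_def)
      have xk: "x k \<noteq> 0"
        using nz xy by simp
      have sums: "(\<Sum>j=1..n. Y (Y1 j) * x j) = 0" "(\<Sum>j=1..n. Y (Y1 j) * y j) = 0"
        using sum[of x] sum[of y] off by (simp_all add: xy)
      have loc: "lc_eval Y (CE k l) (x k) (y k) = 0" "lc_eval Y (CE m l') (x m) (y m) = 0"
      proof -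
        show "lc_eval Y (CE k l) (x k) (y k) = 0"
          by (simp add: lc_eval_CE_eq_0_iff PQ xy)
        have "Y (bvar Q) * x m + Y (cvar Q) * y m = ?a * (Y (bvar P) * Y (cvar Q) - Y (cvar P) * Y (bvar Q))"
          by (simp add: xy algebra_simps)
        then show "lc_eval Y (CE m l') (x m) (y m) = 0"
          using q by (simp add: lc_eval_CE_eq_0_iff PQ)
      qed
      have supp: "(j - 1 \<notin> ?C \<longrightarrow> x j = 0) \<and> (n + j - 1 \<notin> ?C \<longrightarrow> y j = 0)" for j
        using off[of j] by auto
      have row: "case row_label n r of (k, c) \<Rightarrow> lc_eval Y c (x k) (y k) = 0" if "r \<in> ?E" "2 \<le> r" for r
      proof -
        have "r = i \<or> r = i'"
          using that by auto
        then show ?thesis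
          using loc i(3) i'(3) by auto
      qed
      have "kernel_vector n Y ?H x y"
        unfolding kernel_vector_row_set[OF E]
      proof (intro conjI)
        show "\<exists>k\<in>{1..n}. x k \<noteq> 0 \<or> y k \<noteq> 0"
          using xk km(1) by blast
        show "\<forall>r\<in>?E. 2 \<le> r \<longrightarrow> (case row_label n r of (k, c) \<Rightarrow> lc_eval Y c (x k) (y k) = 0)"
          by (intro ballI impI) (rule row)
        show "\<forall>j\<in>{1..n}. (j - 1 \<notin> ?C \<longrightarrow> x j = 0) \<and> (n + j - 1 \<notin> ?C \<longrightarrow> y j = 0)"
          by (intro ballI) (rule supp)
      qed (simp_all only: sums simp_thms)
      then show "\<exists>x y. kernel_vector n Y ?H x y"
        by blast
    qed
    finally show ?thesis .
  qed
  ultimately show ?thesis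
    using H by blast
qed

section \<open>The algebraic boundary is the union of the walls\<close>

lemma eventually_off_zero_set:
  assumes "Y \<in> topspace (RM n)" "v \<in> vars n" "p \<in> polys n" "Y \<notin> zero_set n {p}"
  shows "eventually (\<lambda>t. Y(v := t) \<notin> zero_set n {p}) (at (Y v))"
proof -
  obtain r where r: "\<And>t. eval_poly p (\<lambda>w. Polynomial.poly (if w = v then [:0, 1:] else [:Y w:]) t) = Polynomial.poly r t"
    using eval_poly_curve[of p "\<lambda>w. if w = v then [:0, 1:] else [:Y w:]"] by blast
  have "(\<lambda>w. Polynomial.poly (if w = v then [:0, 1:] else [:Y w:]) t) = Y(v := t)" for t
    by auto
  then have eval: "eval_poly p (Y(v := t)) = Polynomial.poly r t" for t
    using r[of t] by simp
  have "Polynomial.poly r (Y v) \<noteq> 0"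
    using assms(1,4) eval[of "Y v"] by (simp add: zero_set_def)
  moreover have "(Polynomial.poly r \<longlongrightarrow> Polynomial.poly r (Y v)) (at (Y v))"
    using continuous_within_poly[of "Y v" UNIV r] by (simp add: continuous_within)
  ultimately have "eventually (\<lambda>t. Polynomial.poly r t \<noteq> 0) (at (Y v))"
    using tendsto_imp_eventually_ne by blast
  then show ?thesis
    by eventually_elim (simp add: zero_set_def eval)
qed

text \<open>
  Along the line through \<open>Y\<close> in a suitable coordinate direction, the other walls are avoided near \<open>Y\<close> and \<open>V\<close> is
  met only at \<open>Y\<close>; a minor with a zero there is provided by the preceding lemmas.
\<close>

lemma wall_point_in_frontier:
  assumes V: "V \<in> walls n" and Y: "Y \<in> V" and others: "\<And>W. W \<in> walls n \<Longrightarrow> W \<noteq> V \<Longrightarrow> Y \<notin> W"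
  shows "\<exists>R\<in>maximal_open_regions n. Y \<in> (RM n) frontier_of (Abstract_Topology.closure_of (RM n) R)"
proof -
  have top: "Y \<in> topspace (RM n)"
    using V Y walls_subset_topspace by blast
  have witness: ?thesis
    if v: "v \<in> vars n" and H: "H \<in> max_row_sets n" "affine_fun (\<lambda>t. max_minor n (Y(v := t)) H)"
      and zero: "max_minor n Y H = 0"
      and off: "\<And>t. t \<noteq> Y v \<Longrightarrow> Y(v := t) \<notin> V"
      and nz: "\<And>t. generic n (Y(v := t)) \<Longrightarrow> max_minor n (Y(v := t)) H \<noteq> 0" for v H
  proof -
    have "eventually (\<lambda>t. Y(v := t) \<notin> W) (at (Y v))" if W: "W \<in> walls n" for W
    proof (cases "W = V")
      case True
      then show ?thesis
        using off by (simp add: eventually_at_filter)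
    next
      case False
      obtain p where "p \<in> polys n" "W = zero_set n {p}"
        using wall_eq_zero_set[OF W] by blast
      then show ?thesis
        using eventually_off_zero_set[OF top v, of p] others[OF W False] by simp
    qed
    then have "eventually (\<lambda>t. \<forall>W\<in>walls n. Y(v := t) \<notin> W) (at (Y v))"
      by (intro eventually_ball_finite finite_walls) simp
    then have "eventually (\<lambda>t. generic n (Y(v := t)) \<and> max_minor n (Y(v := t)) H \<noteq> 0) (at (Y v))"
    proof eventually_elim
      case (elim t)
      then have "generic n (Y(v := t))"
        using topspace_RM_upd[OF top v] by (simp add: generic_def)
      then show ?case
        using nz by simp
    qed
    then show ?thesis
      by (rule sign_change_in_frontier[OF top v H zero])
  qed
  show ?thesis
    using V
  proof (cases rule: wall_cases)
    case (hyperplane v)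
    obtain H where H: "H \<in> max_row_sets n" "\<And>Y. affine_fun (\<lambda>t. max_minor n (Y(v := t)) H)"
      "\<And>Y. max_minor n Y H = 0 \<longleftrightarrow> Y v = 0"
      using hyperplane_minor[OF hyperplane(1)] by blast
    have Yv: "Y v = 0"
      using Y hyperplane by (simp add: mem_coordinate_hyperplane)
    show ?thesis
    proof (rule witness[OF hyperplane(1) H(1,2)])
      show "max_minor n Y H = 0"
        using H(3) Yv by simp
      show "Y(v := t) \<notin> V" if "t \<noteq> Y v" for t
        using that Yv hyperplane by (simp add: mem_coordinate_hyperplane)
      show "max_minor n (Y(v := t)) H \<noteq> 0" if "generic n (Y(v := t))" for t
        using H(3) genericD(2)[OF that hyperplane(1)] by simp
    qed
  next
    case (quadric P Q)
    note PQ = this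
    have v: "bvar P \<in> vars n"
      using PQ by simp
    obtain H where H: "H \<in> max_row_sets n" "\<And>Y. affine_fun (\<lambda>t. max_minor n (Y(bvar P := t)) H)"
      "\<And>Y. \<forall>v\<in>vars n. Y v \<noteq> 0 \<Longrightarrow> max_minor n Y H = 0 \<longleftrightarrow> Y (bvar P) * Y (cvar Q) = Y (cvar P) * Y (bvar Q)"
      using quadric_minor[OF PQ(1-3)] by blast
    have nz: "Y w \<noteq> 0" if w: "w \<in> vars n" for w
    proof -
      have W: "coordinate_hyperplane n w \<in> walls n"
        using w unfolding walls_def by blast
      have "coordinate_hyperplane n w \<noteq> V"
      proof
        assume "coordinate_hyperplane n w = V"
        moreover have "restrict (\<lambda>_. 1) (vars n) \<in> V"
          using PQ by (simp add: mem_slope_quadric topspace_RM)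
        ultimately show False
          using w by (auto simp: mem_coordinate_hyperplane)
      qed
      then show ?thesis
        using others[OF W] top by (simp add: mem_coordinate_hyperplane)
    qed
    have q: "Y (bvar P) * Y (cvar Q) = Y (cvar P) * Y (bvar Q)"
      using Y PQ by (simp add: mem_slope_quadric)
    show ?thesis
    proof (rule witness[OF v H(1,2)])
      show "max_minor n Y H = 0"
        using H(3)[of Y] nz q by simp
      show "Y(bvar P := t) \<notin> V" if "t \<noteq> Y (bvar P)" for t
      proof
        assume "Y(bvar P := t) \<in> V"
        then have "t * Y (cvar Q) = Y (cvar P) * Y (bvar Q)"
          using PQ by (simp add: mem_slope_quadric)
        then have "t * Y (cvar Q) = Y (bvar P) * Y (cvar Q)"
          using q by simp
        then show False
          using nz[of "cvar Q"] PQ that by simp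
      qed
      show "max_minor n (Y(bvar P := t)) H \<noteq> 0" if "generic n (Y(bvar P := t))" for t
        using H(3)[of "Y(bvar P := t)"] genericD(2)[OF that] genericD(3)[OF that PQ(1-3)] by blast
    qed
  qed
qed

text \<open>
  One inclusion holds since the union of the walls is an algebraic set that contains all frontiers. For
  the other, a wall \<open>V\<close> is covered by the other walls and the boundary, because its remaining points lie in
  frontiers. As \<open>V\<close> is irreducible and lies in no other wall, it lies in the boundary, which is algebraic as
  a finite union of closures.
\<close>

lemma stratification_boundary_eq: "stratification_boundary n = \<Union>(walls n)"
proof
  let ?cl = "\<lambda>R. Abstract_Topology.closure_of (RM n) R"
  have sub: "algebraic_boundary n (?cl R) \<subseteq> \<Union>(walls n)" if "R \<in> maximal_open_regions n" for R
    unfolding algebraic_boundary_def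
    by (intro zariski_closure_subset algebraic_set_Union finite_walls algebraic_set_wall
        frontier_subset_walls that)
  then show "stratification_boundary n \<subseteq> \<Union>(walls n)"
    unfolding stratification_boundary_def by blast
  have alg: "algebraic_set n (stratification_boundary n)"
    unfolding stratification_boundary_def algebraic_boundary_def
    by (intro algebraic_set_Union finite_imageI finite_maximal_open_regions)
      (auto intro!: algebraic_set_zariski_closure dest: subsetD[OF frontier_of_subset_topspace])
  show "\<Union>(walls n) \<subseteq> stratification_boundary n"
  proof (rule Union_least)
    fix V assume V: "V \<in> walls n"
    let ?\<V> = "insert (stratification_boundary n) (walls n - {V})"
    have "V \<subseteq> \<Union>?\<V>"
    proof
      fix Y assume Y: "Y \<in> V"
      show "Y \<in> \<Union>?\<V>"
      proof (cases "\<exists>W\<in>walls n. W \<noteq> V \<and> Y \<in> W")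
        case True
        then show ?thesis
          by blast
      next
        case False
        then obtain R where R: "R \<in> maximal_open_regions n" "Y \<in> (RM n) frontier_of (?cl R)"
          using wall_point_in_frontier[OF V Y] by blast
        then have "Y \<in> algebraic_boundary n (?cl R)"
          unfolding algebraic_boundary_def using subset_zariski_closure by blast
        then have "Y \<in> stratification_boundary n"
          using R(1) unfolding stratification_boundary_def by blast
        then show ?thesis
          by simp
      qed
    qed
    moreover have "finite ?\<V>" "\<And>W. W \<in> ?\<V> \<Longrightarrow> algebraic_set n W"
      using finite_walls alg algebraic_set_wall by auto
    ultimately obtain W where W: "W \<in> ?\<V>" "V \<subseteq> W"
      using irreducible_set_subset_Union[OF irreducible_set_wall[OF V]] by blast
    show "V \<subseteq> stratification_boundary n"
    proof (cases "W = stratification_boundary n")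
      case False
      then have "W \<in> walls n" "W \<noteq> V"
        using W(1) by auto
      then show ?thesis
        using walls_antichain[OF V _ W(2)] by blast
    qed (use W in simp)
  qed
qed

section \<open>The binomials are \<open>4 \<times> 4\<close> minors\<close>

lemma det_mat_Suc:
  fixes f :: "nat \<times> nat \<Rightarrow> 'a :: comm_ring_1"
  shows "det (mat (Suc n) (Suc n) f) =
    (\<Sum>j<Suc n. f (0, j) * ((- 1) ^ j * det (mat n n (\<lambda>(r, c). f (Suc r, if c < j then c else Suc c)))))"
proof -
  have "mat_delete (mat (Suc n) (Suc n) f) 0 j = mat n n (\<lambda>(r, c). f (Suc r, if c < j then c else Suc c))" for j
    by (intro eq_matI) (auto simp: mat_delete_def)
  then show ?thesis
    by (subst laplace_expansion_row[of _ "Suc n" 0]) (simp_all add: cofactor_def)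
qed

lemma det_two_global_two_local_rows:
  fixes a a' b b' c c' :: real
  shows "det (mat 4 4 (\<lambda>(r, j). [[a, a', 0, 0], [0, 0, - a, - a'], [b, 0, c, 0], [0, b', 0, c']] ! r ! j)) =
      a * a' * (c * b' - b * c')"
    and "det (mat 4 4 (\<lambda>(r, j). [[a, a', 0, 0], [0, 0, - a, - a'], [0, b', 0, c'], [b, 0, c, 0]] ! r ! j)) =
      a * a' * (b * c' - c * b')"
  by (simp_all add: eval_nat_numeral det_mat_Suc lessThan_Suc algebra_simps)

lemma pick_4:
  assumes "a < b" "b < c" "c < (d::nat)"
  shows "pick {a, b, c, d} 0 = a" "pick {a, b, c, d} 1 = b" "pick {a, b, c, d} 2 = c" "pick {a, b, c, d} 3 = d"
proof -
  let ?S = "{a, b, c, d}"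
  have "{x \<in> ?S. x < a} = {}" "{x \<in> ?S. x < b} = {a}" "{x \<in> ?S. x < c} = {a, b}" "{x \<in> ?S. x < d} = {a, b, c}"
    using assms by auto
  then have "card {x \<in> ?S. x < a} = 0" "card {x \<in> ?S. x < b} = 1" "card {x \<in> ?S. x < c} = 2" "card {x \<in> ?S. x < d} = 3"
    using assms by simp_all
  then show "pick ?S 0 = a" "pick ?S 1 = b" "pick ?S 2 = c" "pick ?S 3 = d"
    using pick_card_in_set[of a ?S] pick_card_in_set[of b ?S] pick_card_in_set[of c ?S] pick_card_in_set[of d ?S]
    by (metis insertCI)+
qed

lemma minor_4:
  assumes I: "i0 < i1" "i1 < i2" "i2 < i3" "i3 < num_rows n" and J: "j0 < j1" "j1 < j2" "j2 < j3" "j3 < 2 * n"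
  shows "minor n Y {i0, i1, i2, i3} {j0, j1, j2, j3} =
    det (mat 4 4 (\<lambda>(r, c). A_entry n Y ([i0, i1, i2, i3] ! r) ([j0, j1, j2, j3] ! c)))"
proof -
  let ?I = "{i0, i1, i2, i3}" and ?J = "{j0, j1, j2, j3}"
  have "{i. i < num_rows n \<and> i \<in> ?I} = ?I" "{j. j < 2 * n \<and> j \<in> ?J} = ?J"
    using I J by auto
  moreover have "card ?I = 4" "card ?J = 4"
    using I J by simp_all
  moreover have "pick ?I r = [i0, i1, i2, i3] ! r" "pick ?J r = [j0, j1, j2, j3] ! r" if "r < 4" for r
  proof -
    have "r = 0 \<or> r = 1 \<or> r = 2 \<or> r = 3"
      using that by linarith
    then show "pick ?I r = [i0, i1, i2, i3] ! r" "pick ?J r = [j0, j1, j2, j3] ! r"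
      using pick_4[OF I(1-3)] pick_4[OF J(1-3)] by (auto simp del: pick.simps)
  qed
  moreover have "[i0, i1, i2, i3] ! r < num_rows n" "[j0, j1, j2, j3] ! r < 2 * n" if "r < 4" for r
  proof -
    have "r = 0 \<or> r = 1 \<or> r = 2 \<or> r = 3"
      using that by linarith
    then show "[i0, i1, i2, i3] ! r < num_rows n" "[j0, j1, j2, j3] ! r < 2 * n"
      using I J by auto
  qed
  ultimately have "submatrix (A_mat n Y) ?I ?J =
      mat 4 4 (\<lambda>(r, c). A_entry n Y ([i0, i1, i2, i3] ! r) ([j0, j1, j2, j3] ! c))"
    by (intro eq_matI) (simp_all add: submatrix_def A_mat_index)
  then show ?thesis
    by (simp add: minor_def)
qed

text \<open>
  The minor has the rows of player 1 and one row of player 2 at each of \<open>k\<close> and \<open>m\<close>. Its sign depends on the order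
  of the two rows and on the orientations of the pairs; exchanging \<open>P\<close> and \<open>Q\<close> negates the slope
  binomial and thus absorbs a negative sign.
\<close>

lemma given_by_minor_slope_binomial_aux:
  assumes km: "k < m" "k \<noteq> l" "m \<noteq> l'" "{k, l, m, l'} \<subseteq> {1..n}"
    and PQ: "sorted_pair k l = P" "sorted_pair m l' = Q"
  shows "given_by_minor n 4 (slope_binomial P Q) \<or> given_by_minor n 4 (slope_binomial Q P)"
proof -
  have bd: "k \<in> {1..n}" "l \<in> {1..n}" "m \<in> {1..n}" "l' \<in> {1..n}"
    using km(4) by simp_all
  obtain i where i: "2 \<le> i" "i < 2 + n * (n - 1)" "row_label n i = (k, CE k l)"
    using ex_player2_row[OF bd(1,2) km(2)] by blast
  obtain i' where i': "2 \<le> i'" "i' < 2 + n * (n - 1)" "row_label n i' = (m, CE m l')"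
    using ex_player2_row[OF bd(3,4) km(3)] by blast
  let ?J = "{k - 1, m - 1, n + k - 1, n + m - 1}" and ?I = "{0, 1, i, i'}"
  have J: "k - 1 < m - 1" "m - 1 < n + k - 1" "n + k - 1 < n + m - 1" "n + m - 1 < 2 * n"
    using bd km(1) by auto
  \<comment> \<open>The monomial factor that this minor has besides the slope binomial.\<close>
  define mono where "mono = Poly_Mapping.single (Y1 k) (1::nat) + Poly_Mapping.single (Y1 m) 1"
  have mono: "Poly_Mapping.keys mono \<subseteq> vars n" "eval_monom mono Y = Y (Y1 k) * Y (Y1 m)" for Y
    using bd km(1) eval_monom_single[of _ Y]
    by (simp_all add: mono_def keys_single_add_single eval_monom_add)
  define s where "s = (if k < l then 1 else - 1 :: real)"
  define s' where "s' = (if m < l' then 1 else - 1 :: real)"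
  have rows: "i < num_rows n" "i' < num_rows n"
    using i i' by (simp_all add: num_rows_def)
  have neq: "i \<noteq> i'"
    using i(3) i'(3) km(1) by auto
  have I: "?I \<subseteq> {..<num_rows n}" "card ?I = 4" "?J \<subseteq> {..<2 * n}" "card ?J = 4"
    using i i' neq rows J by auto
  obtain k0 m0 where k0: "k = Suc k0" and m0: "m = Suc m0"
    using bd by (metis One_nat_def Suc_le_D atLeastAtMost_iff)
  have lt: "k0 < m0" "k0 < n" "m0 < n"
    using bd km(1) by (simp_all add: k0 m0)
  have lc: "lc_eval Y (CE k l) 1 0 = s * Y (bvar P)" "lc_eval Y (CE k l) 0 1 = s * Y (cvar P)"
    "lc_eval Y (CE m l') 1 0 = s' * Y (bvar Q)" "lc_eval Y (CE m l') 0 1 = s' * Y (cvar Q)" for Y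
    unfolding lc_eval_CE PQ s_def s'_def by simp_all
  have entries:
    "A_entry n Y 0 (k - 1) = Y (Y1 k)" "A_entry n Y 0 (m - 1) = Y (Y1 m)"
    "A_entry n Y 0 (n + k - 1) = 0" "A_entry n Y 0 (n + m - 1) = 0"
    "A_entry n Y 1 (k - 1) = 0" "A_entry n Y 1 (m - 1) = 0"
    "A_entry n Y 1 (n + k - 1) = - Y (Y1 k)" "A_entry n Y 1 (n + m - 1) = - Y (Y1 m)"
    "A_entry n Y i (k - 1) = s * Y (bvar P)" "A_entry n Y i (m - 1) = 0"
    "A_entry n Y i (n + k - 1) = s * Y (cvar P)" "A_entry n Y i (n + m - 1) = 0"
    "A_entry n Y i' (k - 1) = 0" "A_entry n Y i' (m - 1) = s' * Y (bvar Q)"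
    "A_entry n Y i' (n + k - 1) = 0" "A_entry n Y i' (n + m - 1) = s' * Y (cvar Q)" for Y
    using lt i(1) i'(1) i(3) i'(3) lc[of Y] unfolding k0 m0 by (simp_all add: A_entry_def)
  let ?rows = "\<lambda>Y. [[Y (Y1 k), Y (Y1 m), 0, 0], [0, 0, - Y (Y1 k), - Y (Y1 m)]]"
  let ?e = "\<lambda>Y. [s * Y (bvar P), 0, s * Y (cvar P), 0]" and ?e' = "\<lambda>Y. [0, s' * Y (bvar Q), 0, s' * Y (cvar Q)]"
  have four: "r = 0 \<or> r = 1 \<or> r = 2 \<or> r = 3" if "r < 4" for r :: nat
    using that by linarith
  have "\<exists>\<sigma>::real. (\<sigma> = 1 \<or> \<sigma> = - 1) \<and> (\<forall>Y. minor n Y ?I ?J =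
      \<sigma> * (Y (Y1 k) * Y (Y1 m) * (Y (bvar P) * Y (cvar Q) - Y (cvar P) * Y (bvar Q))))"
  proof (cases "i < i'")
    case True
    have "minor n Y ?I ?J = - (s * s') * (Y (Y1 k) * Y (Y1 m) * (Y (bvar P) * Y (cvar Q) - Y (cvar P) * Y (bvar Q)))" for Y
    proof -
      have "mat 4 4 (\<lambda>(r, c). A_entry n Y ([0, 1, i, i'] ! r) ([k - 1, m - 1, n + k - 1, n + m - 1] ! c)) =
          mat 4 4 (\<lambda>(r, c). (?rows Y @ [?e Y, ?e' Y]) ! r ! c)" (is "?M = ?M'")
      proof (rule eq_matI)
        fix r c assume "r < dim_row ?M'" "c < dim_col ?M'"
        then have "r = 0 \<or> r = 1 \<or> r = 2 \<or> r = 3" "c = 0 \<or> c = 1 \<or> c = 2 \<or> c = 3"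
          using four[of r] four[of c] by simp_all
        then show "?M $$ (r, c) = ?M' $$ (r, c)"
          by (elim disjE) (simp_all add: entries[simplified])
      qed simp_all
      then have "minor n Y ?I ?J = det (mat 4 4 (\<lambda>(r, c). (?rows Y @ [?e Y, ?e' Y]) ! r ! c))"
        using minor_4[of 0 1 i i', OF _ _ True _ J] i rows by simp
      then show ?thesis
        by (simp add: det_two_global_two_local_rows algebra_simps)
    qed
    then show ?thesis
      by (intro exI[of _ "- (s * s')"]) (simp add: s_def s'_def)
  next
    case False
    then have lt: "i' < i"
      using neq by simp
    have "minor n Y ?I ?J = s * s' * (Y (Y1 k) * Y (Y1 m) * (Y (bvar P) * Y (cvar Q) - Y (cvar P) * Y (bvar Q)))" for Y
    proof -
      have "mat 4 4 (\<lambda>(r, c). A_entry n Y ([0, 1, i', i] ! r) ([k - 1, m - 1, n + k - 1, n + m - 1] ! c)) =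
          mat 4 4 (\<lambda>(r, c). (?rows Y @ [?e' Y, ?e Y]) ! r ! c)" (is "?M = ?M'")
      proof (rule eq_matI)
        fix r c assume "r < dim_row ?M'" "c < dim_col ?M'"
        then have "r = 0 \<or> r = 1 \<or> r = 2 \<or> r = 3" "c = 0 \<or> c = 1 \<or> c = 2 \<or> c = 3"
          using four[of r] four[of c] by simp_all
        then show "?M $$ (r, c) = ?M' $$ (r, c)"
          by (elim disjE) (simp_all add: entries[simplified])
      qed simp_all
      then have "minor n Y {0, 1, i', i} ?J = det (mat 4 4 (\<lambda>(r, c). (?rows Y @ [?e' Y, ?e Y]) ! r ! c))"
        using minor_4[of 0 1 i' i, OF _ _ lt _ J] i' rows by simp
      moreover have "{0, 1, i', i} = ?I"
        by auto
      ultimately show ?thesis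
        by (simp add: det_two_global_two_local_rows algebra_simps)
    qed
    then show ?thesis
      by (intro exI[of _ "s * s'"]) (simp add: s_def s'_def)
  qed
  then obtain \<sigma> :: real where \<sigma>: "\<sigma> = 1 \<or> \<sigma> = - 1" "\<And>Y. minor n Y ?I ?J =
      \<sigma> * (Y (Y1 k) * Y (Y1 m) * (Y (bvar P) * Y (cvar Q) - Y (cvar P) * Y (bvar Q)))"
    by blast
  have given: "given_by_minor n 4 p" if "\<And>Y. minor n Y ?I ?J = eval_monom mono Y * eval_poly p Y" for p
    unfolding given_by_minor_def
    by (rule exI[of _ ?I], rule exI[of _ ?J], rule exI[of _ mono]) (use I mono that in simp)
  show ?thesis
    using \<sigma>(1)
  proof
    assume "\<sigma> = 1"
    then have "given_by_minor n 4 (slope_binomial P Q)"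
      by (intro given, unfold \<sigma>(2) mono(2)) simp
    then show ?thesis ..
  next
    assume "\<sigma> = - 1"
    then have "given_by_minor n 4 (slope_binomial Q P)"
      by (intro given, unfold \<sigma>(2) mono(2)) (simp add: algebra_simps)
    then show ?thesis ..
  qed
qed

lemma given_by_minor_slope_binomial:
  assumes "P \<in> pairs n" "Q \<in> pairs n" "P \<noteq> Q"
  shows "given_by_minor n 4 (slope_binomial P Q) \<or> given_by_minor n 4 (slope_binomial Q P)"
proof -
  obtain k l m l' where kl: "k \<noteq> m" "k \<noteq> l" "m \<noteq> l'" "{k, l, m, l'} \<subseteq> {1..n}"
    "sorted_pair k l = P" "sorted_pair m l' = Q"
    using distinct_pairs_rows[OF assms] by blast
  show ?thesis
  proof (cases "k < m")
    case True
    then show ?thesis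
      by (rule given_by_minor_slope_binomial_aux) (use kl in simp_all)
  next
    case False
    then have "m < k"
      using kl(1) by simp
    then have "given_by_minor n 4 (slope_binomial Q P) \<or> given_by_minor n 4 (slope_binomial P Q)"
      by (rule given_by_minor_slope_binomial_aux) (use kl in auto)
    then show ?thesis
      by blast
  qed
qed

theorem theorem5p8:
  fixes n :: nat
  assumes "n \<ge> 1"
  shows "\<exists>Q. Q \<subseteq> {p \<in> polys n. quadratic_binomial p \<and>
                        (given_by_minor n 2 p \<or> given_by_minor n 4 p)} \<and>
             irreducible_components n (stratification_boundary n) =
               {coordinate_hyperplane n v | v. v \<in> vars n} \<union> {zero_set n {p} | p. p \<in> Q}"
proof (intro exI conjI)
  let ?Q = "{slope_binomial P Q | P Q. P \<in> pairs n \<and> Q \<in> pairs n \<and> P \<noteq> Q \<and> given_by_minor n 4 (slope_binomial P Q)}"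
  show "?Q \<subseteq> {p \<in> polys n. quadratic_binomial p \<and> (given_by_minor n 2 p \<or> given_by_minor n 4 p)}"
    using slope_binomial_polys quadratic_binomial_slope_binomial by blast
  have quadrics: "{slope_quadric n P Q | P Q. P \<in> pairs n \<and> Q \<in> pairs n \<and> P \<noteq> Q} = {zero_set n {p} | p. p \<in> ?Q}"
  proof (intro Set.equalityI subsetI)
    fix V assume "V \<in> {slope_quadric n P Q | P Q. P \<in> pairs n \<and> Q \<in> pairs n \<and> P \<noteq> Q}"
    then obtain P Q where PQ: "P \<in> pairs n" "Q \<in> pairs n" "P \<noteq> Q" "V = slope_quadric n P Q"
      by blast
    have V: "V = zero_set n {slope_binomial P Q}" "V = zero_set n {slope_binomial Q P}"
      using PQ(4) slope_quadric_commute[of n P Q] by (simp_all add: slope_quadric_def)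
    have "slope_binomial P Q \<in> ?Q \<or> slope_binomial Q P \<in> ?Q"
      using given_by_minor_slope_binomial[OF PQ(1-3)] PQ(1-3) by blast
    then show "V \<in> {zero_set n {p} | p. p \<in> ?Q}"
      using V by blast
  next
    fix V assume "V \<in> {zero_set n {p} | p. p \<in> ?Q}"
    then show "V \<in> {slope_quadric n P Q | P Q. P \<in> pairs n \<and> Q \<in> pairs n \<and> P \<noteq> Q}"
      unfolding slope_quadric_def by blast
  qed
  have "irreducible_components n (stratification_boundary n) = walls n"
    unfolding stratification_boundary_eq
    by (rule irreducible_components_Union_antichain[OF finite_walls irreducible_set_wall walls_antichain])
  then show "irreducible_components n (stratification_boundary n) =
      {coordinate_hyperplane n v | v. v \<in> vars n} \<union> {zero_set n {p} | p. p \<in> ?Q}"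
    unfolding quadrics[symmetric] walls_def .
qed

end
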